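(* Let $\overline\omega\in\mathbb{R}^2/\mathbb{Z}^2$ be totally irrational, let $f\in\mathrm{Homeo}(\mathbb{T}^2,\mathrm{Vol})\cap\mathcal{C}_{\overline\omega}$ be minimal, and let $G^0_f$ be the set of all $g\in\mathrm{Homeo}(\mathbb{T}^2,\mathrm{Vol})\cap\mathrm{Homeo}_*(\mathbb{T}^2)$ with $gf=fg$. Then $G^0_f$ is isomorphic (as a group) to a subgroup of $\mathbb{R}^2/\mathbb{Z}^2$. Moreover, $G^0_f$ is compact in the $C^0$ topology if and only if $f$ is topologically linearizable.
   Context: $\mathbb{T}^2=\mathbb{R}^2/\mathbb{Z}^2$. $\mathrm{Homeo}_*(\mathbb{T}^2)$ is the group of homeomorphisms of $\mathbb{T}^2$ isotopic to the identity, and $\mathrm{Homeo}(\mathbb{T}^2,\mathrm{Vol})$ is the group of homeomorphisms of $\mathbb{T}^2$ preserving Lebesgue measure. $T_{\overline\omega}(z)=z+\overline\omega$ is the translation. $\mathcal{C}_{\overline\omega}$ is the set of $f\in\mathrm{Homeo}_*(\mathbb{T}^2)$ for which there is a surjective continuous map $h:\mathbb{T}^2\to\mathbb{T}^2$ homotopic to $\mathrm{Id}_{\mathbb{T}^2}$ with $hf=T_{\overline\omega}h$. $\overline\omega=(\omega_1,\omega_2)\bmod\mathbb{Z}^2$ is totally irrational if $\omega_1,\omega_2,1$ are linearly independent over $\mathbb{Q}$. $f$ is minimal if every orbit is dense. $f$ is topologically linearizable if it is topologically conjugate (by a homeomorphism of $\mathbb{T}^2$) to a translation. The $C^0$ topology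 is that of uniform convergence. *)

theory Defs
  imports "HOL-Analysis.Analysis" "HOL-Algebra.Bij"
begin

section \<open>The torus\<close>

abbreviation Z2 :: "(real \<times> real) set"
  where "Z2 \<equiv> \<int> \<times> \<int>"

definition torus_rel :: "real \<times> real \<Rightarrow> real \<times> real \<Rightarrow> bool"
  where "torus_rel x y \<longleftrightarrow> x - y \<in> Z2"

lemma Z2_zero: "0 \<in> Z2"
  by (simp add: zero_prod_def)

lemma Z2_add: "x \<in> Z2 \<Longrightarrow> y \<in> Z2 \<Longrightarrow> x + y \<in> Z2"
  by (auto simp: mem_Times_iff)

lemma Z2_diff: "x \<in> Z2 \<Longrightarrow> y \<in> Z2 \<Longrightarrow> x - y \<in> Z2"
  by (auto simp: mem_Times_iff)

lemma Z2_minus: "- x \<in> Z2 \<longleftrightarrow> x \<in> Z2"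
  by (auto simp: mem_Times_iff)

lemma closed_Z2: "closed Z2"
  by (intro closed_Times closed_Ints)

lemma torus_rel_equivp: "equivp torus_rel"
proof (intro equivpI reflpI sympI transpI)
  show "torus_rel x x" for x
    using Z2_zero by (simp add: torus_rel_def)
  show "torus_rel y x" if "torus_rel x y" for x y
    using that Z2_minus[of "x - y"] by (simp add: torus_rel_def)
  show "torus_rel x z" if "torus_rel x y" "torus_rel y z" for x y z
    using Z2_add[of "x - y" "y - z"] that by (simp add: torus_rel_def)
qed

quotient_type torus = "real \<times> real" / torus_rel
  morphisms rep_torus to_torus
  by (rule torus_rel_equivp)

instantiation torus :: ab_group_add
begin

lift_definition zero_torus :: torus is "0" .

lift_definition plus_torus :: "torus \<Rightarrow> torus \<Rightarrow> torus" is "(+)"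
proof -
  fix a b c d :: "real \<times> real"
  assume "torus_rel a b" "torus_rel c d"
  then have "(a - b) + (c - d) \<in> Z2"
    unfolding torus_rel_def by (rule Z2_add)
  also have "(a - b) + (c - d) = (a + c) - (b + d)"
    by simp
  finally show "torus_rel (a + c) (b + d)"
    unfolding torus_rel_def .
qed

lift_definition uminus_torus :: "torus \<Rightarrow> torus" is "uminus"
proof -
  fix a b :: "real \<times> real"
  assume "torus_rel a b"
  then show "torus_rel (- a) (- b)"
    using Z2_minus[of "a - b"] unfolding torus_rel_def by (simp only: minus_diff_eq minus_diff_minus)
qed

lift_definition minus_torus :: "torus \<Rightarrow> torus \<Rightarrow> torus" is "(-)"
proof -
  fix a b c d :: "real \<times> real"
  assume "torus_rel a b" "torus_rel c d"
  then have "(a - b) - (c - d) \<in> Z2"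
    unfolding torus_rel_def by (rule Z2_diff)
  also have "(a - b) - (c - d) = (a - c) - (b - d)"
    by simp
  finally show "torus_rel (a - c) (b - d)"
    unfolding torus_rel_def .
qed

instance
proof
  fix a b c :: torus
  have eq: "torus_rel x y" if "x = y" for x y
    using that Z2_zero by (simp add: torus_rel_def)
  show "a + b + c = a + (b + c)" "a + b = b + a" "0 + a = a" "- a + a = 0" "a - b = a + - b"
    by (transfer, rule eq, simp)+
qed

end

lemma to_torus_add: "to_torus (x + y) = to_torus x + to_torus y"
  by (simp add: plus_torus.abs_eq)

lemma infdist_Z2_cong_le:
  assumes "x - y \<in> Z2"
  shows "infdist x Z2 \<le> infdist y Z2"
proof -
  obtain l where l: "l \<in> Z2" "infdist y Z2 = dist y l"
    using infdist_attains_inf[OF closed_Z2, of y] Z2_zero by blast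
  have "infdist x Z2 \<le> dist x (l + (x - y))"
    by (intro infdist_le Z2_add l assms)
  then show ?thesis
    by (simp add: l dist_norm algebra_simps)
qed

lemma infdist_Z2_cong: "x - y \<in> Z2 \<Longrightarrow> infdist x Z2 = infdist y Z2"
  by (metis Z2_minus antisym infdist_Z2_cong_le minus_diff_eq)

lemma infdist_Z2_minus_le: "infdist (- x) Z2 \<le> infdist x Z2"
proof -
  obtain l where l: "l \<in> Z2" "infdist x Z2 = dist x l"
    using infdist_attains_inf[OF closed_Z2, of x] Z2_zero by blast
  have "infdist (- x) Z2 \<le> dist (- x) (- l)"
    by (intro infdist_le) (simp only: Z2_minus l)
  then show ?thesis
    by (simp add: l dist_norm norm_minus_commute)
qed

lemma infdist_Z2_add_le: "infdist (x + y) Z2 \<le> infdist x Z2 + infdist y Z2"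
proof -
  obtain k where k: "k \<in> Z2" "infdist x Z2 = dist x k"
    using infdist_attains_inf[OF closed_Z2, of x] Z2_zero by blast
  obtain l where l: "l \<in> Z2" "infdist y Z2 = dist y l"
    using infdist_attains_inf[OF closed_Z2, of y] Z2_zero by blast
  have "infdist (x + y) Z2 \<le> dist (x + y) (k + l)"
    by (intro infdist_le Z2_add k l)
  also have "\<dots> \<le> dist x k + dist y l"
    by (rule dist_triangle_add)
  finally show ?thesis
    by (simp add: k l)
qed

text \<open>The quotient metric; lemma \<open>open_torus_iff\<close> shows that it induces the quotient topology.\<close>

instantiation torus :: metric_space
begin

lift_definition dist_torus :: "torus \<Rightarrow> torus \<Rightarrow> real"
  is "\<lambda>x y. infdist (x - y) Z2"
proof -
  fix x x' y y' :: "real \<times> real"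
  assume "torus_rel x x'" "torus_rel y y'"
  then have "(x - y) - (x' - y') \<in> Z2"
    using Z2_diff[of "x - x'" "y - y'"] by (simp add: torus_rel_def algebra_simps)
  then show "infdist (x - y) Z2 = infdist (x' - y') Z2"
    by (rule infdist_Z2_cong)
qed

definition uniformity_torus :: "(torus \<times> torus) filter"
  where "uniformity_torus = (INF e\<in>{0<..}. principal {(x, y). dist x y < e})"

definition open_torus :: "torus set \<Rightarrow> bool"
  where "open_torus U \<longleftrightarrow> (\<forall>x\<in>U. \<forall>\<^sub>F (x', y) in uniformity. x' = x \<longrightarrow> y \<in> U)"

instance
proof
  show "dist x y = 0 \<longleftrightarrow> x = y" for x y :: torus
  proof transfer
    fix x y :: "real \<times> real"
    have "Z2 \<noteq> {}"
      using Z2_zero by blast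
    then show "infdist (x - y) Z2 = 0 \<longleftrightarrow> torus_rel x y"
      unfolding torus_rel_def by (rule in_closed_iff_infdist_zero[OF closed_Z2, symmetric])
  qed
  show "dist x y \<le> dist x z + dist y z" for x y z :: torus
  proof transfer
    fix x y z :: "real \<times> real"
    show "infdist (x - y) Z2 \<le> infdist (x - z) Z2 + infdist (y - z) Z2"
      using infdist_Z2_add_le[of "x - z" "z - y"] infdist_Z2_minus_le[of "y - z"] by simp
  qed
qed (simp_all add: uniformity_torus_def open_torus_def)

end

lemma dist_to_torus: "dist (to_torus x) (to_torus y) = infdist (x - y) Z2"
  by (simp add: dist_torus.abs_eq)

lemma dist_to_torus_le: "dist (to_torus x) (to_torus y) \<le> dist x y"
  using infdist_le[OF Z2_zero, of "x - y"] by (simp add: dist_to_torus dist_norm)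

lemma continuous_on_to_torus: "continuous_on S to_torus"
proof (rule continuous_onI)
  fix x :: "real \<times> real" and e :: real
  assume "e > 0"
  moreover have "dist (to_torus x') (to_torus x) \<le> e" if "dist x' x < e" for x'
    using dist_to_torus_le[of x' x] that by linarith
  ultimately show "\<exists>d>0. \<forall>x'\<in>S. dist x' x < d \<longrightarrow> dist (to_torus x') (to_torus x) \<le> e"
    by blast
qed

lemma open_torus_iff: "open U \<longleftrightarrow> open (to_torus -` U)"
proof
  assume "open U"
  then show "open (to_torus -` U)"
    by (intro open_vimage continuous_on_to_torus)
next
  assume V: "open (to_torus -` U)"
  show "open U"
    unfolding open_dist
  proof
    fix x assume "x \<in> U"
    obtain a where a: "x = to_torus a"
      by (metis Quotient3_abs_rep Quotient3_torus)
    then obtain e where e: "e > 0" "ball a e \<subseteq> to_torus -` U"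
      using V \<open>x \<in> U\<close> by (metis openE vimageI2)
    have "y \<in> U" if "dist y x < e" for y
    proof -
      obtain b where b: "y = to_torus b"
        by (metis Quotient3_abs_rep Quotient3_torus)
      obtain l where l: "l \<in> Z2" "infdist (b - a) Z2 = dist (b - a) l"
        using infdist_attains_inf[OF closed_Z2, of "b - a"] Z2_zero by blast
      have "dist (b - a) l < e"
        using that by (simp add: a b dist_to_torus l)
      then have "b - l \<in> ball a e"
        by (simp add: dist_norm norm_minus_commute algebra_simps)
      moreover have "to_torus (b - l) = y"
        using l(1) Z2_minus[of l] unfolding b torus.abs_eq_iff torus_rel_def by simp
      ultimately show ?thesis
        using e by blast
    qed
    then show "\<exists>e>0. \<forall>y. dist y x < e \<longrightarrow> y \<in> U"
      using e(1) by blast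
  qed
qed

lemma to_torus_image_square: "to_torus ` ({0..<1} \<times> {0..<1}) = UNIV"
proof -
  have "z \<in> to_torus ` ({0..<1} \<times> {0..<1})" for z
  proof -
    obtain a where a: "z = to_torus a"
      by (metis Quotient3_abs_rep Quotient3_torus)
    have "a - (frac (fst a), frac (snd a)) \<in> Z2"
      by (simp add: mem_Times_iff frac_def)
    then have "z = to_torus (frac (fst a), frac (snd a))"
      unfolding a torus.abs_eq_iff torus_rel_def .
    then show ?thesis
      by (rule image_eqI) (simp add: frac_lt_1)
  qed
  then show ?thesis
    by blast
qed

lemma compact_torus: "compact (UNIV :: torus set)"
proof -
  have "compact (to_torus ` ({0..1} \<times> {0..1}))"
    by (intro compact_continuous_image continuous_on_to_torus compact_Times compact_Icc)
  moreover have "to_torus ` ({0..<1} \<times> {0..<1}) \<subseteq> to_torus ` ({0..1} \<times> {0..1})"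
    by (intro image_mono) auto
  ultimately show ?thesis
    by (simp add: to_torus_image_square top.extremum_unique)
qed

text \<open>Lebesgue measure on the torus, transported from the fundamental domain.\<close>

definition vol :: "torus measure"
  where "vol = distr (restrict_space lborel ({0..<1} \<times> {0..<1})) borel to_torus"

lemma sets_vol [simp]: "sets vol = sets borel"
  by (simp add: vol_def)

lemma to_torus_measurable [measurable]: "to_torus \<in> borel_measurable borel"
  by (intro borel_measurable_continuous_onI continuous_on_to_torus)

lemma emeasure_vol:
  assumes "A \<in> sets borel"
  shows "emeasure vol A = emeasure lborel (to_torus -` A \<inter> ({0..<1} \<times> {0..<1}))"
proof -
  let ?Q = "{0..<1} \<times> {0..<1} :: (real \<times> real) set"
  have Q: "?Q \<in> sets borel"
    by (intro borel_Times) auto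
  have m: "to_torus \<in> measurable (restrict_space lborel ?Q) borel"
    by (intro measurable_restrict_space1) simp
  show ?thesis
    unfolding vol_def emeasure_distr[OF m assms]
    using Q by (simp add: space_restrict_space emeasure_restrict_space)
qed


section \<open>Groups of homeomorphisms\<close>

definition Homeo :: "(torus \<Rightarrow> torus) set"
  where "Homeo = {f. \<exists>g. homeomorphism UNIV UNIV f g}"

text \<open>An isotopy is a homotopy all of whose stages are homeomorphisms.\<close>

definition Homeo_isotopic_id :: "(torus \<Rightarrow> torus) set"
  where "Homeo_isotopic_id =
    {f. homotopic_with_canon (\<lambda>k. k \<in> Homeo) UNIV UNIV id f}"

definition Homeo_vol :: "(torus \<Rightarrow> torus) set"
  where "Homeo_vol = {f \<in> Homeo. distr vol vol f = vol}"

definition translation :: "torus \<Rightarrow> torus \<Rightarrow> torus"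
  where "translation \<omega> z = z + \<omega>"

definition semiconj_class :: "torus \<Rightarrow> (torus \<Rightarrow> torus) set"
  where "semiconj_class \<omega> = {f \<in> Homeo_isotopic_id.
    \<exists>h. continuous_on UNIV h \<and> surj h \<and> homotopic_with_canon (\<lambda>_. True) UNIV UNIV h id
      \<and> h \<circ> f = translation \<omega> \<circ> h}"

text \<open>The inner condition does not depend on the representative, since it is invariant under adding
  integers to \<open>\<omega>1\<close> and \<open>\<omega>2\<close>.\<close>

definition totally_irrational :: "torus \<Rightarrow> bool"
  where "totally_irrational \<omega> \<longleftrightarrow> (\<exists>\<omega>1 \<omega>2. \<omega> = to_torus (\<omega>1, \<omega>2) \<and>
    (\<forall>a b c :: rat. of_rat a * \<omega>1 + of_rat b * \<omega>2 + of_rat c * (1::real) = 0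
        \<longrightarrow> a = 0 \<and> b = 0 \<and> c = 0))"

text \<open>The two-sided orbit. The inverse is written \<open>inv_into UNIV f\<close> because \<open>inv\<close> denotes
  the group inverse of HOL-Algebra here.\<close>

definition orbit :: "(torus \<Rightarrow> torus) \<Rightarrow> torus \<Rightarrow> torus set"
  where "orbit f x = {(f ^^ n) x | n. True} \<union> {(inv_into UNIV f ^^ n) x | n. True}"

definition minimal :: "(torus \<Rightarrow> torus) \<Rightarrow> bool"
  where "minimal f \<longleftrightarrow> (\<forall>x. closure (orbit f x) = UNIV)"

definition topologically_linearizable :: "(torus \<Rightarrow> torus) \<Rightarrow> bool"
  where "topologically_linearizable f \<longleftrightarrow>
    (\<exists>\<phi>\<in>Homeo. \<exists>\<alpha>. \<phi> \<circ> f = translation \<alpha> \<circ> \<phi>)"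

definition centralizer0 :: "(torus \<Rightarrow> torus) \<Rightarrow> (torus \<Rightarrow> torus) set"
  where "centralizer0 f = {g \<in> Homeo_vol \<inter> Homeo_isotopic_id. g \<circ> f = f \<circ> g}"

text \<open>The metric of \<open>torus \<Rightarrow>\<^sub>C torus\<close> is the supremum metric, so its topology is that of
  uniform convergence. Compactness is intrinsic, so it does not matter that the limits are
  a priori only continuous maps.\<close>

definition C0_compact :: "(torus \<Rightarrow> torus) set \<Rightarrow> bool"
  where "C0_compact G \<longleftrightarrow> compact {\<phi> :: torus \<Rightarrow>\<^sub>C torus. apply_bcontfun \<phi> \<in> G}"

definition torus_group :: "torus monoid"
  where "torus_group = \<lparr>carrier = UNIV, monoid.mult = (+), one = 0\<rparr>"

text \<open>\<open>BijGroup UNIV\<close> is the group of all bijections under composition;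
  see \<open>subgroup_centralizer0\<close> below.\<close>

definition centralizer0_group :: "(torus \<Rightarrow> torus) \<Rightarrow> (torus \<Rightarrow> torus) monoid"
  where "centralizer0_group f = (BijGroup UNIV)\<lparr>carrier := centralizer0 f\<rparr>"

lemma group_torus_group: "group torus_group"
proof (rule groupI)
  show "\<exists>y\<in>carrier torus_group. y \<otimes>\<^bsub>torus_group\<^esub> x = \<one>\<^bsub>torus_group\<^esub>" for x
    by (rule bexI[of _ "- x"]) (auto simp: torus_group_def)
qed (auto simp: torus_group_def)

text \<open>No continuous self-map of the torus is lost in passing to the type of bounded
  continuous functions.\<close>

lemma bij_betw_C0:
  assumes "G \<subseteq> Homeo"
  shows "bij_betw apply_bcontfun {\<phi> :: torus \<Rightarrow>\<^sub>C torus. apply_bcontfun \<phi> \<in> G} G"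
proof -
  have "g \<in> apply_bcontfun ` {\<phi>. apply_bcontfun \<phi> \<in> G}" if "g \<in> G" for g
  proof -
    have c: "continuous_on UNIV g"
      using that assms by (auto simp: Homeo_def homeomorphism_def)
    then have "bounded (range g)"
      by (intro compact_imp_bounded compact_continuous_image compact_torus)
    with c have "g \<in> bcontfun"
      by (simp add: bcontfun_def)
    then obtain \<phi> where "g = apply_bcontfun \<phi>"
      by (rule bcontfunE)
    with that show ?thesis
      by blast
  qed
  then show ?thesis
    by (auto simp: bij_betw_def inj_on_def apply_bcontfun_inject)
qed

lemma Homeo_comp: "f \<in> Homeo \<Longrightarrow> g \<in> Homeo \<Longrightarrow> f \<circ> g \<in> Homeo"
  unfolding Homeo_def by (blast intro: homeomorphism_compose)

lemma Homeo_bij: "f \<in> Homeo \<Longrightarrow> bij f"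
  unfolding Homeo_def homeomorphism_def
  by (auto simp: bij_def inj_def) (metis UNIV_I)

lemma Homeo_inv:
  assumes "f \<in> Homeo"
  shows "inv_into UNIV f \<in> Homeo"
proof -
  obtain g where g: "homeomorphism UNIV UNIV f g"
    using assms by (auto simp: Homeo_def)
  then have "inv_into UNIV f = g"
    using Homeo_bij[OF assms] by (auto simp: homeomorphism_def bij_def inv_f_eq fun_eq_iff)
  then show ?thesis
    using homeomorphism_symD[OF g] by (auto simp: Homeo_def)
qed

lemma Homeo_continuous: "f \<in> Homeo \<Longrightarrow> continuous_on UNIV f"
  by (auto simp: Homeo_def homeomorphism_def)

lemma Homeo_measurable: "f \<in> Homeo \<Longrightarrow> f \<in> measurable vol vol"
  using borel_measurable_continuous_onI[OF Homeo_continuous]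
  by (simp cong: measurable_cong_sets)

lemma id_Homeo: "id \<in> Homeo"
  unfolding Homeo_def using homeomorphism_ident[of UNIV] by (auto simp: id_def)

lemma Homeo_isotopic_id_subset: "Homeo_isotopic_id \<subseteq> Homeo"
  unfolding Homeo_isotopic_id_def using homotopic_with_imp_property by blast

lemma isotopy_precomp:
  assumes "homotopic_with_canon (\<lambda>k. k \<in> Homeo) UNIV UNIV p q" "g \<in> Homeo"
  shows "homotopic_with_canon (\<lambda>k. k \<in> Homeo) UNIV UNIV (p \<circ> g) (q \<circ> g)"
  by (rule homotopic_with_compose_continuous_map_right[OF assms(1)])
    (use assms(2) in \<open>auto intro: Homeo_comp Homeo_continuous\<close>)

lemma Homeo_isotopic_id_comp:
  assumes "f \<in> Homeo_isotopic_id" "g \<in> Homeo_isotopic_id"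
  shows "f \<circ> g \<in> Homeo_isotopic_id"
proof -
  have "homotopic_with_canon (\<lambda>k. k \<in> Homeo) UNIV UNIV (id \<circ> g) (f \<circ> g)"
    by (rule isotopy_precomp) (use assms Homeo_isotopic_id_subset in \<open>auto simp: Homeo_isotopic_id_def\<close>)
  then show ?thesis
    using assms(2) by (auto simp: Homeo_isotopic_id_def intro: homotopic_with_trans)
qed

lemma Homeo_isotopic_id_inv:
  assumes "f \<in> Homeo_isotopic_id"
  shows "inv_into UNIV f \<in> Homeo_isotopic_id"
proof -
  have f: "f \<in> Homeo"
    using assms Homeo_isotopic_id_subset by blast
  have "homotopic_with_canon (\<lambda>k. k \<in> Homeo) UNIV UNIV (id \<circ> inv_into UNIV f) (f \<circ> inv_into UNIV f)"
    by (rule isotopy_precomp) (use assms f Homeo_inv in \<open>auto simp: Homeo_isotopic_id_def\<close>)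
  moreover have "f \<circ> inv_into UNIV f = id"
    using Homeo_bij[OF f] surj_iff bij_is_surj by blast
  ultimately show ?thesis
    by (simp add: Homeo_isotopic_id_def homotopic_with_symD)
qed

lemma Homeo_vol_comp:
  assumes "f \<in> Homeo_vol" "g \<in> Homeo_vol"
  shows "f \<circ> g \<in> Homeo_vol"
  using assms distr_distr[of f vol vol g vol]
  by (simp add: Homeo_vol_def Homeo_comp Homeo_measurable)

lemma Homeo_vol_inv:
  assumes "f \<in> Homeo_vol"
  shows "inv_into UNIV f \<in> Homeo_vol"
proof -
  have f: "f \<in> Homeo" "distr vol vol f = vol"
    using assms by (auto simp: Homeo_vol_def)
  have "distr vol vol (inv_into UNIV f) = distr (distr vol vol f) vol (inv_into UNIV f)"
    by (simp add: f)
  also have "\<dots> = distr vol vol (inv_into UNIV f \<circ> f)"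
    by (intro distr_distr Homeo_measurable f Homeo_inv)
  also have "inv_into UNIV f \<circ> f = (\<lambda>x. x)"
    using Homeo_bij[OF f(1)] by (simp add: bij_def inj_iff id_def)
  finally show ?thesis
    by (simp add: Homeo_vol_def f Homeo_inv distr_id)
qed

lemma Bij_UNIV: "Bij UNIV = {f. bij f}"
  by (simp add: Bij_def)

lemma subgroup_centralizer0: "subgroup (centralizer0 f) (BijGroup UNIV)"
proof -
  interpret group "BijGroup (UNIV :: torus set)"
    by (rule group_BijGroup)
  have bij: "bij g" if "g \<in> centralizer0 f" for g
    using that by (auto simp: centralizer0_def Homeo_vol_def Homeo_bij)
  show ?thesis
  proof (rule subgroupI)
    show "centralizer0 f \<subseteq> carrier (BijGroup UNIV)"
      using bij by (auto simp: BijGroup_def Bij_UNIV)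
    have "id \<in> Homeo_isotopic_id"
      by (simp add: Homeo_isotopic_id_def id_Homeo)
    moreover have "id \<in> Homeo_vol"
      using id_Homeo by (simp add: Homeo_vol_def distr_id id_def)
    ultimately show "centralizer0 f \<noteq> {}"
      by (auto simp: centralizer0_def)
  next
    fix g assume g: "g \<in> centralizer0 f"
    then have "bij g" by (rule bij)
    then have "inv\<^bsub>BijGroup UNIV\<^esub> g = inv_into UNIV g"
      by (subst inv_BijGroup) (auto simp: Bij_UNIV)
    moreover have "inv_into UNIV g \<circ> f = f \<circ> inv_into UNIV g"
    proof
      fix x
      have "g (f (inv_into UNIV g x)) = f (g (inv_into UNIV g x))"
        using g by (auto simp: centralizer0_def fun_eq_iff)
      then have "g (f (inv_into UNIV g x)) = f x"
        using \<open>bij g\<close> by (simp add: bij_is_surj surj_f_inv_f)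
      then show "(inv_into UNIV g \<circ> f) x = (f \<circ> inv_into UNIV g) x"
        using \<open>bij g\<close> by (metis bij_inv_eq_iff comp_apply)
    qed
    ultimately show "inv\<^bsub>BijGroup UNIV\<^esub> g \<in> centralizer0 f"
      using g by (auto simp: centralizer0_def Homeo_vol_inv Homeo_isotopic_id_inv)
  next
    fix g k assume gk: "g \<in> centralizer0 f" "k \<in> centralizer0 f"
    then have "g \<otimes>\<^bsub>BijGroup UNIV\<^esub> k = g \<circ> k"
      using bij by (auto simp: BijGroup_def Bij_UNIV compose_def fun_eq_iff)
    moreover have "g \<circ> k \<circ> f = f \<circ> (g \<circ> k)"
      using gk by (auto simp: centralizer0_def fun_eq_iff)
    ultimately show "g \<otimes>\<^bsub>BijGroup UNIV\<^esub> k \<in> centralizer0 f"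
      using gk by (auto simp: centralizer0_def Homeo_vol_comp Homeo_isotopic_id_comp)
  qed
qed

lemma group_centralizer0_group: "group (centralizer0_group f)"
  unfolding centralizer0_group_def
  by (intro subgroup.subgroup_is_group subgroup_centralizer0 group_BijGroup)

end

theory Submission
  imports Defs "HOL-Algebra.Coset"
begin

text \<open>Let \<open>h\<close> be the semiconjugacy from \<open>f\<close> to the translation by \<open>\<omega>\<close>. If \<open>g\<close> commutes with \<open>f\<close>, then \<open>h \<circ> g - h\<close> is
continuous and \<open>f\<close>-invariant, hence a constant \<open>\<rho> g\<close> because \<open>f\<close> is minimal
(\<open>commuting_map_is_translation_downstairs\<close>). This defines a homomorphism \<open>\<rho>\<close> from the centralizer to the torus,
and the first claim is that it is injective.

An element \<open>g\<close> of the kernel satisfies \<open>h \<circ> g = h\<close>. As \<open>h\<close> is homotopic to the identity, its lift to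
the plane has bounded fibres, and a suitable lift of \<open>g\<close> preserves each of them. So this lift has bounded orbits,
and by Brouwer's theorem on plane homeomorphisms it has a fixed point
(\<open>fixed_point_if_fibres_preserved\<close>). The fixed points of \<open>g\<close> form a closed \<open>f\<close>-invariant
set, so minimality gives \<open>g = id\<close>.

Brouwer's theorem is proved here for injective continuous maps of the plane whose displacement is bounded
(\<open>bounded_orbit_fixed_point\<close>). A returning orbit can be closed up to a periodic one without creating fixed
points, so periodic points have to be excluded for maps without fixed points. Period \<open>2\<close> is impossible
because the angle by which the map turns the vector between two points is symmetric in them (\<open>no_swap\<close>).
A period \<open>k \<ge> 3\<close> can be shortened by perturbing the map inside the largest disc
around the periodic point that is disjoint from its image (\<open>period_reduction\<close>); this is in the spirit of
the orbit closing proofs of Brouwer's lemma on translation arcs.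

If the centralizer is compact, its orbit of a point is closed and \<open>f\<close>-invariant, so it acts transitively; injectivity
of \<open>\<rho>\<close> then makes \<open>h\<close> injective, and \<open>h\<close> is the required conjugacy. If, conversely, a homeomorphism
conjugates \<open>f\<close> to a translation, the centralizer consists of the conjugates of all translations
(\<open>linearizable_centralizer_eq\<close>): they preserve volume because the iterates of \<open>f\<close> do and volume
preservation survives uniform limits. So the centralizer is a continuous image of the torus.\<close>

section \<open>Difference quotients of plane embeddings\<close>

lemma continuous_log_of_one_constant:
  fixes k :: "'a::topological_space \<Rightarrow> complex"
  assumes "connected S" "continuous_on S k" "\<And>x. x \<in> S \<Longrightarrow> exp (k x) = 1"
  shows "k constant_on S"
proof (rule continuous_discrete_range_constant [OF assms(1,2)])
  fix x assume x: "x \<in> S"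
  have "k y = k x" if "y \<in> S" "norm (k y - k x) < 2 * pi" for y
  proof (rule exp_complex_eqI)
    have "\<bar>Im (k y - k x)\<bar> \<le> norm (k y - k x)" by (rule abs_Im_le_cmod)
    then show "\<bar>Im (k y) - Im (k x)\<bar> < 2 * pi" using that by simp
    show "exp (k y) = exp (k x)" using assms(3) x that by simp
  qed
  then show "\<exists>e>0. \<forall>y. y \<in> S \<and> k y \<noteq> k x \<longrightarrow> e \<le> norm (k y - k x)"
    by (intro exI[of _ "2*pi"]) (auto simp: not_less[symmetric])
qed

text \<open>Bounded displacement plays the role of orientation preservation below: far out, such a map turns
the vector between two points by a small angle only, so it can be compared with the identity
without constructing an isotopy. The class contains the lifts of torus homeomorphisms homotopic
to the identity and is closed under composition, which is what the perturbations need.\<close>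

definition near_id_embedding :: "(complex \<Rightarrow> complex) \<Rightarrow> bool"
  where "near_id_embedding f \<longleftrightarrow>
    continuous_on UNIV f \<and> inj f \<and> bounded (range (\<lambda>z. f z - z))"

lemma near_id_embedding_comp:
  assumes "near_id_embedding f" "near_id_embedding g"
  shows "near_id_embedding (f \<circ> g)"
proof -
  obtain B where B: "\<And>z. norm (f z - z) \<le> B"
    using assms(1) unfolding near_id_embedding_def bounded_iff by blast
  obtain C where C: "\<And>z. norm (g z - z) \<le> C"
    using assms(2) unfolding near_id_embedding_def bounded_iff by blast
  have "norm (f (g z) - z) \<le> B + C" for z
    using B[of "g z"] C[of z] norm_triangle_ineq[of "f (g z) - g z" "g z - z"] by simp
  then show ?thesis
    using assms unfolding near_id_embedding_def bounded_iff
    by (auto intro!: inj_compose continuous_on_compose intro: continuous_on_subset simp del: o_apply)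
      (auto simp: o_def)
qed

lemma connected_distinct_pairs: "connected {(p, q :: complex). p \<noteq> q}"
proof -
  have "connected ((\<lambda>(p, u). (p, p + u)) ` (UNIV \<times> (- {0 :: complex})))"
    by (intro connected_continuous_image connected_Times connected_punctured_universe)
       (auto intro!: continuous_intros simp: case_prod_unfold)
  moreover have "(\<lambda>(p, u). (p, p + u)) ` (UNIV \<times> (- {0 :: complex})) = {(p, q). p \<noteq> q}"
  proof (intro equalityI subsetI)
    fix x :: "complex \<times> complex" assume "x \<in> {(p, q). p \<noteq> q}"
    then show "x \<in> (\<lambda>(p, u). (p, p + u)) ` (UNIV \<times> (- {0}))"
      by (intro image_eqI[of _ _ "(fst x, snd x - fst x)"]) auto
  qed auto
  ultimately show ?thesis by simp
qed

text \<open>How much \<open>f\<close> turns the vector from \<open>p\<close> to \<open>q\<close> is a well defined real angle, not only an angle modulo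
a full turn. Stretching that vector until it is long deforms the quotient, through nonzero values,
into the disc of radius \<open>1\<close> around \<open>1\<close>; hence the quotient is inessential as a map into the
punctured plane and has a continuous logarithm. The symmetry in \<open>p\<close> and \<open>q\<close> holds because the
difference of the two values is a constant multiple of \<open>2 * pi * \<i>\<close> on a connected space and
changes sign when \<open>p\<close> and \<open>q\<close> are exchanged.\<close>

lemma difference_quotient_log:
  assumes "near_id_embedding f"
  obtains L :: "complex \<times> complex \<Rightarrow> complex"
  where "continuous_on {(p, q). p \<noteq> q} L"
    and "\<And>p q. p \<noteq> q \<Longrightarrow> (f q - f p) / (q - p) = exp (L (p, q))"
    and "\<And>p q. p \<noteq> q \<Longrightarrow> L (q, p) = L (p, q)"
proof -
  let ?S = "UNIV \<times> (- {0 :: complex})"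
  define M where "M = (\<lambda>(p, u). (f (p + u) - f p) / u)"
  obtain B where B: "\<And>z. norm (f z - z) \<le> B"
    using assms unfolding near_id_embedding_def bounded_iff by blast
  have inj: "inj f" and cont: "continuous_on UNIV f"
    using assms by (auto simp: near_id_embedding_def)
  have contf: "continuous_on A (\<lambda>x. f (g x))" if "continuous_on A g"
    for A and g :: "'b::topological_space \<Rightarrow> complex"
    using continuous_on_compose2[OF cont that] by simp
  define K where "K = 2 * B + 1"
  have "B \<ge> 0" using B[of 0] norm_ge_zero order_trans by blast
  then have K: "K > 0" by (simp add: K_def)
  \<comment> \<open>lengthens \<open>u\<close> by \<open>t * K\<close>; at \<open>t = 1\<close> the length exceeds twice the displacement bound\<close>
  define s where "s = (\<lambda>t u :: complex. u * of_real (1 + t * K / norm u))"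
  have pos_s: "1 + t * K / norm u > 0" if "t \<ge> 0" for t and u :: complex
    using that K by (simp add: add_pos_nonneg)
  have norm_s: "norm (s t u) = norm u + t * K" if "t \<ge> 0" "u \<noteq> 0" for t u
  proof -
    have "norm (s t u) = norm u * (1 + t * K / norm u)"
      using pos_s[of t u] that by (simp add: s_def norm_mult del: of_real_add of_real_mult of_real_divide)
    also have "\<dots> = norm u + t * K"
      using that(2) by (simp add: distrib_left)
    finally show ?thesis .
  qed
  have s0: "s t u \<noteq> 0" if "t \<ge> 0" "u \<noteq> 0" for t u
    using pos_s[of t u] that by (simp add: s_def del: of_real_add of_real_mult of_real_divide)
  have M0: "M (p, u) \<noteq> 0" if "u \<noteq> 0" for p u
    using that inj by (simp add: M_def inj_eq)
  have hom: "continuous_on ({0..1} \<times> ?S) (\<lambda>(t, x). M (fst x, s t (snd x)))"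
  proof -
    have s: "continuous_on ({0..1} \<times> ?S) (\<lambda>y. s (fst y) (snd (snd y)))"
      unfolding s_def by (intro continuous_intros) auto
    have "continuous_on ({0..1} \<times> ?S) (\<lambda>y. (f (fst (snd y) + s (fst y) (snd (snd y)))
        - f (fst (snd y))) / s (fst y) (snd (snd y)))"
      by (intro continuous_intros contf s ballI s0) auto
    then show ?thesis by (simp add: M_def case_prod_unfold)
  qed
  have far: "continuous_on ?S (\<lambda>x. M (fst x, s 1 (snd x)))"
  proof -
    have "continuous_on ?S (\<lambda>x. (1::real, x))" by (intro continuous_intros)
    from continuous_on_compose2[OF hom this] show ?thesis by (simp add: image_subset_iff)
  qed
  have pos: "Re (M (p, s 1 u)) > 0" if "u \<noteq> 0" for p u
  proof -
    let ?u = "s 1 u"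
    have nu: "norm ?u > 2 * B" using norm_s[of 1 u] norm_ge_zero[of u] that
      by (simp add: K_def del: norm_ge_zero)
    then have u: "?u \<noteq> 0" using \<open>B \<ge> 0\<close> by auto
    have "M (p, ?u) - 1 = ((f (p + ?u) - (p + ?u)) - (f p - p)) / ?u"
      using u by (simp add: M_def field_simps)
    then have "norm (M (p, ?u) - 1) = norm ((f (p + ?u) - (p + ?u)) - (f p - p)) / norm ?u"
      by (simp add: norm_divide)
    also have "\<dots> \<le> (2 * B) / norm ?u"
      using norm_triangle_ineq4[of "f (p + ?u) - (p + ?u)" "f p - p"] B[of p] B[of "p + ?u"]
      by (intro divide_right_mono) auto
    also have "\<dots> < 1" using nu \<open>B \<ge> 0\<close> by (simp add: divide_less_eq)
    finally show ?thesis
      using abs_Re_le_cmod[of "M (p, ?u) - 1"] by simp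
  qed
  have "continuous_on ?S (\<lambda>x. Ln (M (fst x, s 1 (snd x))))"
    by (intro continuous_on_Ln'[OF far])
      (use pos in \<open>auto simp: complex_nonpos_Reals_iff not_le\<close>)
  moreover have "M (fst x, s 1 (snd x)) = exp (Ln (M (fst x, s 1 (snd x))))" if "x \<in> ?S" for x
    using s0[of 1 "snd x"] M0[of "s 1 (snd x)" "fst x"] that by (simp add: mem_Times_iff)
  ultimately have "\<exists>g. continuous_on ?S g \<and> (\<forall>x\<in>?S. M (fst x, s 1 (snd x)) = exp (g x))"
    by blast
  then obtain a where a: "homotopic_with_canon (\<lambda>h. True) ?S (- {0})
      (\<lambda>x. M (fst x, s 1 (snd x))) (\<lambda>_. a)"
    unfolding inessential_eq_continuous_logarithm[symmetric] by blast
  have "homotopic_with_canon (\<lambda>h. True) ?S (- {0}) M (\<lambda>x. M (fst x, s 1 (snd x)))"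
    unfolding homotopic_with_def
  proof (intro exI conjI)
    show "continuous_map (prod_topology (top_of_set {0..1}) (top_of_set ?S)) (top_of_set (- {0}))
       (\<lambda>(t, x). M (fst x, s t (snd x)))"
      unfolding prod_topology_subtopology_eu
      using hom s0 M0 by (auto simp: Pi_iff)
    show "\<forall>x. (case (1, x) of (t, x) \<Rightarrow> M (fst x, s t (snd x))) = M (fst x, s 1 (snd x))" by simp
    show "\<forall>x. (case (0, x) of (t, x) \<Rightarrow> M (fst x, s t (snd x))) = M x" by (simp add: s_def)
  qed auto
  from homotopic_with_trans[OF this a]
  obtain g where g: "continuous_on ?S g" "\<And>x. x \<in> ?S \<Longrightarrow> M x = exp (g x)"
    using inessential_eq_continuous_logarithm[of ?S M] by blast
  define L where "L = (\<lambda>(p, q). g (p, q - p))"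
  let ?D = "{(p, q :: complex). p \<noteq> q}"
  have L: "continuous_on ?D L"
    unfolding L_def case_prod_unfold
    by (rule continuous_on_compose2[OF g(1)]) (auto intro!: continuous_intros)
  have L_exp: "(f q - f p) / (q - p) = exp (L (p, q))" if "p \<noteq> q" for p q
    using g(2)[of "(p, q - p)"] that by (simp add: M_def L_def)
  have "continuous_on ?D (\<lambda>x. L (snd x, fst x))"
    by (rule continuous_on_compose2[OF L]) (auto intro!: continuous_intros)
  then have "continuous_on ?D (\<lambda>x. L (snd x, fst x) - L x)"
    by (intro continuous_intros L)
  moreover have "exp (L (snd x, fst x) - L x) = 1" if "x \<in> ?D" for x
  proof -
    have "(f (fst x) - f (snd x)) / (fst x - snd x) = (f (snd x) - f (fst x)) / (snd x - fst x)"
      by (metis minus_diff_eq minus_divide_divide)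
    then have "exp (L (snd x, fst x)) = exp (L x)"
      using L_exp[of "fst x" "snd x"] L_exp[of "snd x" "fst x"] that by auto
    then show ?thesis by (simp add: exp_diff)
  qed
  ultimately have "(\<lambda>x. L (snd x, fst x) - L x) constant_on ?D"
    by (intro continuous_log_of_one_constant connected_distinct_pairs) auto
  then obtain c where c: "\<And>x. x \<in> ?D \<Longrightarrow> L (snd x, fst x) - L x = c"
    unfolding constant_on_def by blast
  have "L (q, p) = L (p, q)" if "p \<noteq> q" for p q
    using c[of "(p, q)"] c[of "(q, p)"] that
    by (auto simp: algebra_simps complex_eq_iff)
  with L L_exp that show thesis by blast
qed

text \<open>Let \<open>\<Theta>\<close> be a logarithm of the nonvanishing displacement \<open>f z - z\<close>. Its increase from \<open>z\<close> to \<open>f z\<close>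
differs by a constant from the angle by which \<open>f\<close> turns the vector from \<open>z\<close> to \<open>f z\<close>. If \<open>f\<close>
exchanges \<open>x\<close> and \<open>y\<close>, that angle is the same at \<open>x\<close> and at \<open>y\<close>, so the increase from \<open>x\<close> to \<open>y\<close>
equals the increase from \<open>y\<close> to \<open>x\<close>. Both are then zero, although the displacements at
\<open>x\<close> and \<open>y\<close> are opposite vectors.\<close>

lemma no_swap:
  assumes f: "near_id_embedding f" and free: "\<And>z. f z \<noteq> z"
  shows "f (f x) \<noteq> x"
proof
  assume x: "f (f x) = x"
  obtain L where L: "continuous_on {(p, q). p \<noteq> q} L"
    and L_exp: "\<And>p q. p \<noteq> q \<Longrightarrow> (f q - f p) / (q - p) = exp (L (p, q))"
    and L_sym: "\<And>p q. p \<noteq> q \<Longrightarrow> L (q, p) = L (p, q)"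
    by (rule difference_quotient_log[OF f]) (rule that)
  have contf: "continuous_on UNIV f" using f by (simp add: near_id_embedding_def)
  then have "continuous_on UNIV (\<lambda>z. f z - z)" by (intro continuous_intros)
  then obtain \<Theta> where \<Theta>: "continuous_on UNIV \<Theta>" and \<Theta>_exp: "\<And>z. f z - z = exp (\<Theta> z)"
    using continuous_logarithm_on_contractible[of UNIV "\<lambda>z. f z - z"] free
    by (metis UNIV_I contractible_UNIV eq_iff_diff_eq_0)
  define k where "k = (\<lambda>z. \<Theta> (f z) - \<Theta> z - L (z, f z))"
  have "continuous_on UNIV (\<lambda>z. L (z, f z))"
    by (rule continuous_on_compose2[OF L]) (use free in \<open>auto intro!: continuous_intros contf simp: eq_commute\<close>)
  then have "continuous_on UNIV k"
    unfolding k_def by (intro continuous_intros \<Theta> continuous_on_compose2[OF \<Theta> contf]) auto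
  moreover have "exp (k z) = 1" for z
    using L_exp[of z "f z"] free[of z] \<Theta>_exp[of z] \<Theta>_exp[of "f z"]
    by (simp add: k_def exp_diff)
  ultimately have "k constant_on UNIV"
    by (intro continuous_log_of_one_constant) auto
  then have "k x = k (f x)" by (auto simp: constant_on_def)
  then have "\<Theta> (f x) = \<Theta> x"
    using L_sym[of "f x" x] free[of x] unfolding k_def x by (simp add: algebra_simps)
  then have "f x - x = f (f x) - f x" using \<Theta>_exp[of x] \<Theta>_exp[of "f x"] by simp
  then have "2 * (f x - x) = 0" unfolding x by (simp add: algebra_simps)
  with free[of x] show False by simp
qed



section \<open>Fixed points of plane embeddings with a bounded orbit\<close>

definition free_embedding :: "(complex \<Rightarrow> complex) \<Rightarrow> bool"
  where "free_embedding f \<longleftrightarrow> near_id_embedding f \<and> (\<forall>z. f z \<noteq> z)"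

lemma compact_free_neighbourhood:
  fixes f :: "complex \<Rightarrow> complex"
  assumes "continuous_on UNIV f" "compact A" "connected A" "f ` A \<inter> A = {}"
  obtains E where "open E" "connected E" "A \<subseteq> E" "f ` E \<inter> E = {}"
proof (cases "A = {}")
  case True
  then show ?thesis using that[of "{}"] by simp
next
  case False
  have "compact (f ` A)"
    by (intro compact_continuous_image continuous_on_subset[OF assms(1)] assms subset_UNIV)
  then have "\<exists>d>0. \<forall>x\<in>A. \<forall>y\<in>f ` A. d \<le> dist x y"
    using assms(2,4) by (intro separate_compact_closed compact_imp_closed) (simp_all add: Int_commute)
  then obtain d where d: "d > 0" "\<And>x y. x \<in> A \<Longrightarrow> y \<in> f ` A \<Longrightarrow> d \<le> dist x y"
    by blast
  define N where "N = {x + y |x y. x \<in> A \<and> y \<in> cball (0::complex) 1}"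
  have "compact N"
    unfolding N_def by (intro compact_sums compact_cball assms)
  then have "uniformly_continuous_on N f"
    by (intro compact_uniformly_continuous continuous_on_subset[OF assms(1)] subset_UNIV)
  then have "\<exists>e>0. \<forall>u\<in>N. \<forall>v\<in>N. dist v u < e \<longrightarrow> dist (f v) (f u) < d / 2"
    using d(1) unfolding uniformly_continuous_on_def by (elim allE[of _ "d / 2"]) simp
  then obtain e where e: "e > 0"
    "\<And>u v. u \<in> N \<Longrightarrow> v \<in> N \<Longrightarrow> dist v u < e \<Longrightarrow> dist (f v) (f u) < d / 2"
    by blast
  define r where "r = Min {e, 1, d / 2}"
  have r: "r > 0" "r \<le> e" "r \<le> 1" "r \<le> d / 2" using e d by (auto simp: r_def)
  define E where "E = (\<Union>a\<in>A. ball a r)"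
  have "connected E"
  proof -
    have "E = (\<lambda>z. fst z + snd z) ` (A \<times> ball 0 r)"
    proof (intro equalityI subsetI)
      fix u assume "u \<in> E"
      then obtain a where "a \<in> A" "dist a u < r" by (auto simp: E_def)
      then show "u \<in> (\<lambda>z. fst z + snd z) ` (A \<times> ball 0 r)"
        by (intro image_eqI[of _ _ "(a, u - a)"]) (auto simp: dist_norm norm_minus_commute)
    qed (auto simp: E_def dist_norm intro!: bexI[rotated])
    moreover have "connected ((\<lambda>z. fst z + snd z) ` (A \<times> ball (0::complex) r))"
      by (intro connected_continuous_image connected_Times assms(3) connected_ball continuous_intros)
    ultimately show ?thesis by simp
  qed
  moreover have "f u \<notin> E" if u: "u \<in> E" for u
  proof
    assume "f u \<in> E"
    then obtain b where b: "b \<in> A" "dist b (f u) < r" by (auto simp: E_def)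
    obtain a where a: "a \<in> A" "dist a u < r" using u by (auto simp: E_def)
    have "u - a \<in> cball 0 1" using a r by (simp add: dist_norm norm_minus_commute)
    then have "a + (u - a) \<in> N" "a + 0 \<in> N" unfolding N_def using a(1) by force+
    then have "dist (f u) (f a) < d / 2"
      using a r by (intro e(2)) (simp_all add: dist_commute)
    moreover have "d \<le> dist b (f a)" using d a b by blast
    ultimately show False using dist_triangle[of b "f a" "f u"] b r by linarith
  qed
  moreover have "open E" "A \<subseteq> E" using r by (auto simp: E_def)
  ultimately show ?thesis using that[of E] by blast
qed

text \<open>A homeomorphism with bounded support has bounded displacement, so pushing a point to another one
inside \<open>E\<close> does not leave the class of maps under consideration.\<close>

lemma push_within:
  assumes "open E" "connected E" "a \<in> E" "b \<in> E"
  obtains \<phi> where "near_id_embedding \<phi>" "\<phi> a = b" "\<And>z. z \<notin> E \<Longrightarrow> \<phi> z = z" "\<phi> ` E = E"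
proof -
  have aff: "affine hull E = UNIV"
    using affine_hull_open assms by blast
  have ope: "openin (top_of_set (affine hull E)) E"
    using assms(1) by (simp add: aff)
  obtain \<phi> \<psi> where h: "homeomorphism UNIV UNIV \<phi> \<psi>" "\<phi> a = b"
    and sub: "{z. \<not> (\<phi> z = z \<and> \<psi> z = z)} \<subseteq> E" and bdd: "bounded {z. \<not> (\<phi> z = z \<and> \<psi> z = z)}"
    by (rule homeomorphism_moving_point[OF ope subset_UNIV[of E] _ assms(2-4)]) (use that in \<open>auto simp: aff\<close>)
  let ?K = "{z. \<not> (\<phi> z = z \<and> \<psi> z = z)}"
  have inv: "\<psi> (\<phi> z) = z" "\<phi> (\<psi> z) = z" for z
    using h(1) by (auto simp: homeomorphism_def)
  have K: "\<phi> z \<in> ?K" if "z \<in> ?K" for z using that inv by (metis (mono_tags, lifting) mem_Collect_eq)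
  obtain B where B: "\<And>z. z \<in> ?K \<Longrightarrow> norm z \<le> B" using bdd unfolding bounded_iff by blast
  have "norm (\<phi> z - z) \<le> max 0 (2 * B)" for z
  proof (cases "z \<in> ?K")
    case True
    then show ?thesis using B[OF True] B[OF K[OF True]] norm_triangle_ineq4[of "\<phi> z" z] by simp
  qed auto
  moreover have "inj \<phi>" using inv by (metis injI)
  moreover have "continuous_on UNIV \<phi>" using h by (auto simp: homeomorphism_def)
  ultimately have "near_id_embedding \<phi>"
    unfolding near_id_embedding_def bounded_iff by blast
  moreover have out: "\<phi> z = z" if "z \<notin> E" for z using sub that by blast
  moreover have "\<phi> ` E = E"
  proof (intro equalityI subsetI)
    fix y assume "y \<in> \<phi> ` E"
    then show "y \<in> E" using out inv by (metis imageE)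
  next
    fix y assume "y \<in> E"
    then have "\<psi> y \<in> E" using inv out by metis
    then show "y \<in> \<phi> ` E" using inv by (metis imageI)
  qed
  ultimately show thesis using that h(2) by blast
qed

text \<open>A perturbation inside a set that \<open>f\<close> moves off itself creates no fixed point: a new one would lie
in \<open>E\<close> together with its image under \<open>f\<close>.\<close>

lemma free_embedding_push:
  assumes f: "free_embedding f" and \<phi>: "near_id_embedding \<phi>" "\<And>z. z \<notin> E \<Longrightarrow> \<phi> z = z" "\<phi> ` E = E"
    and E: "f ` E \<inter> E = {}"
  shows "free_embedding (\<phi> \<circ> f)"
  unfolding free_embedding_def
proof (intro conjI allI)
  show "near_id_embedding (\<phi> \<circ> f)"
    using f \<phi>(1) near_id_embedding_comp by (simp add: free_embedding_def)
  fix z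
  show "(\<phi> \<circ> f) z \<noteq> z"
  proof (cases "f z \<in> E")
    case True
    then have "\<phi> (f z) \<in> E" "z \<notin> E" using \<phi>(3) E by blast+
    then show ?thesis by auto
  qed (use f \<phi>(2) in \<open>auto simp: free_embedding_def\<close>)
qed

text \<open>An orbit that returns to \<open>E\<close> can be closed up: pushing the first return back to its starting point
inside \<open>E\<close> produces a periodic point of some fixed-point-free map, of period at most \<open>n\<close>.
The hypothesis is kept relative to \<open>n\<close> because it is the induction hypothesis in the proof that
there are no periodic points at all.\<close>

lemma open_free_no_return:
  assumes noper: "\<And>g j x. free_embedding g \<Longrightarrow> 0 < j \<Longrightarrow> j \<le> n \<Longrightarrow> (g ^^ j) x \<noteq> x"
    and f: "free_embedding f" and E: "open E" "connected E" "f ` E \<inter> E = {}"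
    and j: "0 < j" "j \<le> n" and p: "p \<in> E"
  shows "(f ^^ j) p \<notin> E"
proof
  assume "(f ^^ j) p \<in> E"
  define i where "i = (LEAST i. 0 < i \<and> (f ^^ i) p \<in> E)"
  have i: "0 < i" "(f ^^ i) p \<in> E" and "i \<le> j"
    using LeastI[of "\<lambda>i. 0 < i \<and> (f ^^ i) p \<in> E" j] Least_le[of "\<lambda>i. 0 < i \<and> (f ^^ i) p \<in> E" j]
      \<open>(f ^^ j) p \<in> E\<close> j unfolding i_def by blast+
  have before: "(f ^^ l) p \<notin> E" if "0 < l" "l < i" for l
    using not_less_Least[of l "\<lambda>i. 0 < i \<and> (f ^^ i) p \<in> E"] that unfolding i_def by blast
  obtain \<phi> where \<phi>: "near_id_embedding \<phi>" "\<phi> ((f ^^ i) p) = p" "\<And>z. z \<notin> E \<Longrightarrow> \<phi> z = z" "\<phi> ` E = E"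
    using push_within[OF E(1,2) i(2) p] by blast
  have free: "free_embedding (\<phi> \<circ> f)"
    by (rule free_embedding_push[OF f \<phi>(1,3,4) E(3)])
  have same: "((\<phi> \<circ> f) ^^ l) p = (f ^^ l) p" if "l < i" for l
    using that
  proof (induction l)
    case (Suc l)
    then show ?case using before[of "Suc l"] \<phi>(3) by simp
  qed simp
  obtain l where l: "i = Suc l" using i(1) gr0_implies_Suc by blast
  then have "((\<phi> \<circ> f) ^^ i) p = p" using same[of l] \<phi>(2) by simp
  then show False using noper[OF free i(1)] \<open>i \<le> j\<close> j by simp
qed

lemma compact_free_no_return:
  assumes "\<And>g j x. free_embedding g \<Longrightarrow> 0 < j \<Longrightarrow> j \<le> n \<Longrightarrow> (g ^^ j) x \<noteq> x"
    and f: "free_embedding f" and A: "compact A" "connected A" "f ` A \<inter> A = {}"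
    and j: "0 < j" "j \<le> n" and p: "p \<in> A"
  shows "(f ^^ j) p \<notin> A"
proof -
  have "continuous_on UNIV f" using f by (simp add: free_embedding_def near_id_embedding_def)
  then obtain E where E: "open E" "connected E" "A \<subseteq> E" "f ` E \<inter> E = {}"
    using compact_free_neighbourhood A by metis
  then show ?thesis using open_free_no_return[OF assms(1) f E(1,2,4) j] p by blast
qed

text \<open>The disc around \<open>x\<close> grows until it first touches its own image. The radius is the minimum of
\<open>max (dist x u) (dist x (f u))\<close>, which is attained at a point \<open>z\<close> where the contact happens.\<close>

lemma maximal_free_disc:
  fixes f :: "complex \<Rightarrow> complex"
  assumes cont: "continuous_on UNIV f" and free: "\<And>z. f z \<noteq> z"
  obtains r z where "r > 0" "dist x z \<le> r" "dist x (f z) \<le> r"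
    "\<And>u. dist x u < r \<Longrightarrow> dist x (f u) \<ge> r"
proof -
  define m where "m = (\<lambda>u. max (dist x u) (dist x (f u)))"
  have "continuous_on (cball x (dist x (f x))) m"
    unfolding m_def
    by (intro continuous_on_max continuous_on_dist continuous_on_const continuous_on_id
        continuous_on_subset[OF cont] subset_UNIV)
  moreover have "cball x (dist x (f x)) \<noteq> {}" by simp
  ultimately obtain z where z: "z \<in> cball x (dist x (f x))" "\<And>u. u \<in> cball x (dist x (f x)) \<Longrightarrow> m z \<le> m u"
    using continuous_attains_inf[OF compact_cball] by metis
  have min: "m z \<le> m u" for u
  proof (cases "u \<in> cball x (dist x (f x))")
    case False
    then have "m x \<le> m u" unfolding m_def by (simp add: max_def)
    moreover have "m z \<le> m x" using z(2)[of x] by simp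
    ultimately show ?thesis by linarith
  qed (rule z(2))
  show thesis
  proof (rule that[of "m z" z])
    show "m z > 0" using free[of z] unfolding m_def less_max_iff_disj zero_less_dist_iff by metis
    show "dist x z \<le> m z" "dist x (f z) \<le> m z" by (auto simp: m_def)
    show "m z \<le> dist x (f u)" if "dist x u < m z" for u
      using min[of u] that by (simp add: m_def max_def split: if_splits)
  qed
qed



text \<open>Let \<open>x\<close> have period \<open>k\<close>, let \<open>D\<close> be the largest disc around \<open>x\<close> that is disjoint from its image, and
let \<open>w = f z\<close> be a contact point of \<open>D\<close> and \<open>f ` D\<close>. Moving \<open>x\<close> inside \<open>D\<close> to a point \<open>w'\<close> on the
way to \<open>w\<close> gives a map \<open>f1\<close> for which the arc \<open>A\<close> running from \<open>w'\<close> to \<open>w\<close> and on inside the closure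
of \<open>f ` D\<close> to \<open>f x\<close> is still moved off itself. But \<open>f1\<close> follows the \<open>f\<close>-orbit of \<open>f x\<close> and, at the
moment when \<open>f\<close> would reach \<open>x\<close>, lands at \<open>w'\<close>. So the orbit of \<open>f x\<close> under \<open>f1\<close> returns to \<open>A\<close>
after \<open>k - 1\<close> steps, which shorter periods have already excluded. The induction can only start
at \<open>k = 3\<close>: that the arc is disjoint from its image uses that \<open>f (f D)\<close> misses \<open>D\<close>, which comes from the case of
period \<open>2\<close>.\<close>

lemma period_reduction:
  assumes noper: "\<And>g j x. free_embedding g \<Longrightarrow> 0 < j \<Longrightarrow> j < k \<Longrightarrow> (g ^^ j) x \<noteq> x"
    and k: "k \<ge> 3" and f: "free_embedding f"
  shows "(f ^^ k) x \<noteq> x"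
proof
  assume per: "(f ^^ k) x = x"
  have noper': "\<And>g j x. free_embedding g \<Longrightarrow> 0 < j \<Longrightarrow> j \<le> k - 1 \<Longrightarrow> (g ^^ j) x \<noteq> x"
    using noper by force
  have cont: "continuous_on UNIV f" and inj: "inj f" and nofix: "\<And>z. f z \<noteq> z"
    using f by (auto simp: free_embedding_def near_id_embedding_def)
  have contA: "continuous_on A f" for A by (rule continuous_on_subset[OF cont subset_UNIV])
  obtain r z where r: "r > 0" and z: "dist x z \<le> r" and fz: "dist x (f z) \<le> r"
    and free: "\<And>u. dist x u < r \<Longrightarrow> dist x (f u) \<ge> r"
    using maximal_free_disc[OF cont nofix] by blast
  define w where "w = f z"
  have D: "closure (ball x r) = cball x r" using r by simp
  have free_ball: "f ` ball x r \<inter> ball x r = {}" using free by force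
  have open_image: "open (f ` ball x r)"
    by (intro invariance_of_domain contA) (use inj inj_on_subset in auto)
  \<comment> \<open>Disjointness of an open set from \<open>ball x r\<close> extends to the closed disc; this makes the contact
    of the closed disc with its image happen on both boundaries.\<close>
  have a2: "dist x (f u) > r" if "dist x u < r" for u
  proof -
    have "f ` ball x r \<inter> cball x r = {}"
      using open_Int_closure_eq_empty[OF open_image, of "ball x r"] free_ball D by simp
    then show ?thesis using that by force
  qed
  have a1: "dist x (f u) \<ge> r" if "dist x u \<le> r" for u
  proof (rule ccontr)
    assume "\<not> r \<le> dist x (f u)"
    have "open (f -` ball x r)" using cont by (simp add: open_vimage)
    moreover have "f -` ball x r \<inter> ball x r = {}" using free_ball by blast
    ultimately have "f -` ball x r \<inter> cball x r = {}"
      using open_Int_closure_eq_empty[of "f -` ball x r" "ball x r"] D by simp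
    with that \<open>\<not> r \<le> dist x (f u)\<close> show False by force
  qed
  have two: "(f ^^ 2) ` ball x r \<inter> ball x r = {}"
  proof -
    have "(f ^^ 2) p \<notin> ball x r" if "p \<in> ball x r" for p
      by (rule open_free_no_return[OF noper' f]) (use that free_ball k in auto)
    then show ?thesis by blast
  qed
  have c1: "f (f u) \<notin> ball x r" if "dist x u \<le> r" for u
  proof -
    have "continuous_on UNIV (\<lambda>u. f (f u))" by (intro continuous_on_compose2[OF cont cont]) auto
    then have "open ((\<lambda>u. f (f u)) -` ball x r)" by (simp add: open_vimage)
    moreover have "(\<lambda>u. f (f u)) -` ball x r \<inter> ball x r = {}" using two by (auto simp: numeral_2_eq_2)
    ultimately have "(\<lambda>u. f (f u)) -` ball x r \<inter> cball x r = {}"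
      using open_Int_closure_eq_empty[of "(\<lambda>u. f (f u)) -` ball x r" "ball x r"] D by simp
    with that show ?thesis by force
  qed
  have seg: "dist x u < dist x q \<or> u = q" if u: "u \<in> closed_segment x q" for u q
  proof -
    obtain t where t: "0 \<le> t" "t \<le> 1" "u = (1 - t) *\<^sub>R x + t *\<^sub>R q"
      using u unfolding in_segment by blast
    have "u - x = t *\<^sub>R (q - x)" using t by (simp add: algebra_simps)
    then have "dist x u = norm (t *\<^sub>R (q - x))" by (metis dist_commute dist_norm)
    also have "\<dots> = t * dist x q" using t by (simp add: dist_norm norm_minus_commute)
    finally show ?thesis using t by (cases "t = 1") (auto simp: mult_less_cancel_right2)
  qed
  \<comment> \<open>Only the endpoint \<open>q\<close> of the segment can lie on the boundary circle, so contact of the segment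
    with its image would make \<open>q\<close> a fixed point.\<close>
  have seg_free: "f u \<notin> closed_segment x q" if "dist x q \<le> r" "u \<in> closed_segment x q" for u q
  proof
    assume fu: "f u \<in> closed_segment x q"
    have "\<not> dist x u < dist x q" using seg[OF fu] a2[of u] that(1) by auto
    then have "u = q" using seg[OF that(2)] by blast
    moreover have "f u = q" using seg[OF fu] a1[of u] \<open>u = q\<close> that(1) by auto
    ultimately show False using nofix by metis
  qed
  \<comment> \<open>The other points of the orbit avoid the closed disc: the segment from \<open>x\<close> to such a point would
    be disjoint from its image, yet visited twice by the orbit.\<close>
  have b: "dist x ((f ^^ i) x) > r" if "0 < i" "i < k" for i
  proof (rule ccontr)
    assume "\<not> ?thesis"
    then have "f ` closed_segment x ((f ^^ i) x) \<inter> closed_segment x ((f ^^ i) x) = {}"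
      using seg_free[of "(f ^^ i) x"] by fastforce
    then have "(f ^^ i) x \<notin> closed_segment x ((f ^^ i) x)"
      by (intro compact_free_no_return[OF noper' f]) (use that in auto)
    then show False by simp
  qed
  have z_r: "dist x z = r" and w_r: "dist x w = r"
    using a2[of z] a1[of z] z fz unfolding w_def by linarith+
  have wz: "w \<noteq> z" using nofix w_def by metis
  \<comment> \<open>The point has to lie in the open disc and to differ from \<open>x\<close>, where the radius towards \<open>w\<close> meets
    the segment from \<open>x\<close> to \<open>z\<close>.\<close>
  define w' where "w' = midpoint x w"
  have w'_D: "w' \<in> ball x r" using w_r r by (simp add: w'_def dist_midpoint)
  obtain \<phi> where \<phi>: "near_id_embedding \<phi>" "\<phi> x = w'" "\<And>u. u \<notin> ball x r \<Longrightarrow> \<phi> u = u"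
      "\<phi> ` ball x r = ball x r"
    using push_within[of "ball x r" x w'] w'_D r by auto
  define f1 where "f1 = \<phi> \<circ> f"
  have f1: "free_embedding f1"
    unfolding f1_def by (rule free_embedding_push[OF f \<phi>(1,3,4) free_ball])
  have f1_D: "f1 u = f u" if "dist x u \<le> r" for u
    using a1[OF that] \<phi>(3) by (simp add: f1_def)
  have f1_fD: "f1 (f u) = f (f u)" if "dist x u \<le> r" for u
    using c1[OF that] \<phi>(3) by (simp add: f1_def)
  define A where "A = closed_segment w' w \<union> f ` closed_segment x z"
  have w'w: "closed_segment w' w \<subseteq> closed_segment x w"
    by (simp add: w'_def subset_closed_segment midpoint_in_closed_segment)
  have xw: "dist x u \<le> r" if "u \<in> closed_segment x w" for u
    using seg[OF that] w_r by auto
  have xz: "dist x u \<le> r" if "u \<in> closed_segment x z" for u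
    using seg[OF that] z_r by auto
  have disj: "u \<notin> closed_segment x z" if u: "u \<in> closed_segment w' w" for u
  proof
    assume "u \<in> closed_segment x z"
    \<comment> \<open>\<open>w\<close> and \<open>z\<close> are at the same distance from \<open>x\<close>, so two radii that meet away from \<open>x\<close> have the
      same endpoint\<close>
    then obtain t where t: "0 \<le> t" "u = (1 - t) *\<^sub>R x + t *\<^sub>R z"
      unfolding in_segment by blast
    then have ut: "u - x = t *\<^sub>R (z - x)" by (simp add: algebra_simps)
    obtain a where a: "0 \<le> a" "u = (1 - a) *\<^sub>R w' + a *\<^sub>R w"
      using u unfolding in_segment by blast
    define b where "b = (1 + a) / 2"
    have "u - x = b *\<^sub>R (w - x)"
      unfolding a(2) w'_def b_def midpoint_def by (simp add: complex_eq_iff field_simps)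
    moreover have "b > 0" using a by (simp add: b_def)
    ultimately have "norm (b *\<^sub>R (w - x)) = norm (t *\<^sub>R (z - x))" using ut by metis
    then have "b * r = t * r"
      using w_r z_r \<open>b > 0\<close> t(1) by (simp add: dist_norm norm_minus_commute)
    then have "b = t" using r by simp
    then have "w - x = z - x"
      using \<open>u - x = b *\<^sub>R (w - x)\<close> ut \<open>b > 0\<close> by (metis scaleR_cancel_left less_irrefl)
    then show False using wz by simp
  qed
  have "compact A"
    unfolding A_def by (intro compact_Un compact_continuous_image contA compact_segment)
  moreover have "connected A"
    unfolding A_def
    by (intro connected_Un connected_continuous_image contA connected_segment) (auto simp: w_def)
  moreover have "f1 ` A \<inter> A = {}"
  proof -
    have "f1 u \<notin> A" if u: "u \<in> closed_segment w' w" for u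
    proof
      assume "f1 u \<in> A"
      then have "f u \<in> A" using f1_D[OF xw] u w'w by auto
      moreover have "f u \<notin> closed_segment w' w"
        using seg_free[of w u] w_r u w'w by auto
      moreover have "f u \<notin> f ` closed_segment x z"
        using disj[OF u] inj by (auto simp: inj_def)
      ultimately show False by (simp add: A_def)
    qed
    moreover have "f1 (f u) \<notin> A" if u: "u \<in> closed_segment x z" for u
    proof
      assume "f1 (f u) \<in> A"
      then have "f (f u) \<in> A" using f1_fD[OF xz[OF u]] by simp
      moreover have "f (f u) \<notin> f ` closed_segment x z"
        using seg_free[of z u] z_r u inj by (auto simp: inj_def)
      moreover have "f (f u) \<notin> closed_segment w' w"
      proof
        assume *: "f (f u) \<in> closed_segment w' w"
        then have "f (f u) = w"
          using seg[of "f (f u)" w] w'w c1[OF xz[OF u]] w_r by auto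
        then have "f u = z" using inj by (auto simp: w_def inj_def)
        then show False using seg_free[of z u] z_r u by auto
      qed
      ultimately show False by (simp add: A_def)
    qed
    ultimately show ?thesis by (auto simp: A_def)
  qed
  moreover have "f x \<in> A" by (simp add: A_def)
  moreover have "(f1 ^^ (k - 1)) (f x) = w'"
  proof -
    have step: "(f1 ^^ i) (f x) = (f ^^ Suc i) x" if "i < k - 1" for i
      using that
    proof (induction i)
      case (Suc i)
      have "Suc (Suc i) < k" using Suc.prems by linarith
      then have "(f ^^ Suc (Suc i)) x \<notin> ball x r" using b[of "Suc (Suc i)"] by (auto simp del: funpow.simps)
      then show ?case using Suc \<phi>(3) by (simp add: f1_def)
    qed simp
    obtain l where l: "k = Suc (Suc l)"
      using k by (metis One_nat_def Suc_1 Suc_le_D Suc_le_mono numeral_3_eq_3)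
    have "(f1 ^^ l) (f x) = (f ^^ Suc l) x" by (rule step) (simp add: l)
    then have "(f1 ^^ Suc l) (f x) = \<phi> ((f ^^ k) x)" by (simp add: f1_def l)
    then show ?thesis using per \<phi>(2) l by simp
  qed
  moreover have "w' \<in> A" by (simp add: A_def)
  ultimately show False
    using compact_free_no_return[OF noper' f1, where j = "k - 1" and p = "f x" and A = A] k by auto
qed

lemma no_periodic_point:
  assumes "free_embedding f" "k > 0"
  shows "(f ^^ k) x \<noteq> x"
  using assms
proof (induction k arbitrary: f x rule: less_induct)
  case (less k)
  consider "k = 1" | "k = 2" | "k \<ge> 3" using less.prems by linarith
  then show ?case
  proof cases
    case 1
    then show ?thesis using less.prems by (simp add: free_embedding_def)
  next
    case 2
    then show ?thesis using less.prems no_swap by (simp add: free_embedding_def numeral_2_eq_2)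
  next
    case 3
    then show ?thesis using period_reduction[of k f x] less by blast
  qed
qed

text \<open>A bounded orbit accumulates somewhere. Without fixed points the accumulation point has a connected
open neighbourhood disjoint from its image, and the orbit visits it twice.\<close>

lemma bounded_orbit_fixed_point:
  fixes f :: "complex \<Rightarrow> complex"
  assumes "near_id_embedding f" "bounded (range (\<lambda>n. (f ^^ n) x))"
  shows "\<exists>z. f z = z"
proof (rule ccontr)
  assume "\<nexists>z. f z = z"
  then have free: "free_embedding f" using assms by (simp add: free_embedding_def)
  have cont: "continuous_on UNIV f" using assms by (simp add: near_id_embedding_def)
  obtain l s where s: "strict_mono (s :: nat \<Rightarrow> nat)" and lim: "((\<lambda>n. (f ^^ n) x) \<circ> s) \<longlonglongrightarrow> l"
    using bounded_imp_convergent_subsequence[OF assms(2)] by blast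
  obtain E where E: "open E" "connected E" "{l} \<subseteq> E" "f ` E \<inter> E = {}"
  proof (rule compact_free_neighbourhood[OF cont, of "{l}"])
    show "f ` {l} \<inter> {l} = {}" using free by (auto simp: free_embedding_def)
  qed (use that in auto)
  have "\<forall>\<^sub>F n in sequentially. (f ^^ s n) x \<in> E"
    using topological_tendstoD[OF lim E(1)] E(3) by (simp add: o_def)
  then obtain n where n: "(f ^^ s n) x \<in> E" "(f ^^ s (Suc n)) x \<in> E"
    unfolding eventually_sequentially by (metis le_refl le_SucI)
  have "s n < s (Suc n)" using s by (simp add: strict_mono_def)
  then have "(f ^^ (s (Suc n) - s n)) ((f ^^ s n) x) \<in> E"
    using n(2) by (metis funpow_add le_add_diff_inverse2 less_imp_le o_apply)
  then show False
    using open_free_no_return[OF _ free E(1,2,4) _ order_refl n(1)] no_periodic_point \<open>s n < s (Suc n)\<close>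
    by (metis zero_less_diff)
qed



section \<open>The torus as a topological group, and lifts to the plane\<close>

lemma dist_torus_translate: "dist (a + c) (b + c) = dist a (b :: torus)"
  by transfer simp

lemma dist_torus_uminus: "dist (- a) (- b) = dist a (b :: torus)"
  by transfer (metis antisym infdist_Z2_minus_le minus_diff_minus minus_minus)

lemma dist_torus_add_le: "dist (a + b) (c + d) \<le> dist a c + dist b (d :: torus)"
proof -
  have "dist (a + b) (c + d) \<le> dist (a + b) (c + b) + dist (b + c) (d + c)"
    using dist_triangle[of "a + b" "c + d" "c + b"] by (simp add: add.commute)
  then show ?thesis by (simp add: dist_torus_translate)
qed

lemma dist_torus_diff: "dist (a - b) 0 = dist a (b :: torus)"
  using dist_torus_translate[of a "- b" b] by simp

instance torus :: topological_ab_group_add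
proof
  fix a b :: torus
  have "((\<lambda>x. dist (fst x) a + dist (snd x) b) \<longlongrightarrow> dist a a + dist b b) (nhds a \<times>\<^sub>F nhds b)"
    by (intro tendsto_add tendsto_dist tendsto_const filterlim_fst filterlim_snd)
  then show "((\<lambda>x. fst x + snd x) \<longlongrightarrow> a + b) (nhds a \<times>\<^sub>F nhds b)"
    by (rule metric_tendsto_imp_tendsto) (simp add: dist_torus_add_le dist_real_def)
  have "((\<lambda>x. dist x a) \<longlongrightarrow> dist a a) (nhds a)"
    by (intro tendsto_dist tendsto_const filterlim_ident)
  then show "(uminus \<longlongrightarrow> - a) (nhds a)"
    unfolding tendsto_dist_iff[of uminus] by (simp add: dist_torus_uminus)
qed

lemma to_torus_zero: "to_torus 0 = 0"
  by (simp add: zero_torus.abs_eq)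

lemma to_torus_diff: "to_torus (x - y) = to_torus x - to_torus y"
  by (simp add: minus_torus.abs_eq)

lemma to_torus_eq_iff: "to_torus x = to_torus y \<longleftrightarrow> x - y \<in> Z2"
  by (simp add: torus.abs_eq_iff torus_rel_def)

lemma to_torus_sum: "to_torus (sum s A) = (\<Sum>i\<in>A. to_torus (s i))"
  by (induction A rule: infinite_finite_induct) (auto simp: to_torus_zero to_torus_add)

lemma to_torus_surj: obtains a where "z = to_torus a"
  by (metis Quotient3_abs_rep Quotient3_torus)

lemma norm_Z2_ge_1:
  assumes "l \<in> Z2" "l \<noteq> 0"
  shows "norm l \<ge> 1"
proof -
  obtain m n where l: "l = (m, n)" "m \<in> \<int>" "n \<in> \<int>" using assms by auto
  then have "\<bar>m\<bar> \<ge> 1 \<or> \<bar>n\<bar> \<ge> 1" using assms(2) Ints_nonzero_abs_ge1 by (auto simp: zero_prod_def)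
  then show ?thesis using norm_fst_le[of m n] norm_snd_le[of n m] l(1) by auto
qed

lemma infdist_Z2_small:
  assumes "norm a \<le> 1 / 2"
  shows "infdist a Z2 = norm a"
proof (rule antisym)
  show "infdist a Z2 \<le> norm a" using infdist_le[OF Z2_zero, of a] by simp
  obtain l where l: "l \<in> Z2" "infdist a Z2 = dist a l"
    using infdist_attains_inf[OF closed_Z2, of a] Z2_zero by blast
  show "norm a \<le> infdist a Z2"
  proof (cases "l = 0")
    case False
    then have "norm l \<ge> 1" using norm_Z2_ge_1 l(1) by blast
    then show ?thesis using l(2) assms norm_triangle_ineq2[of l a] by (simp add: dist_norm norm_minus_commute)
  qed (simp add: l)
qed

text \<open>Near \<open>0\<close> this is the local inverse of the projection; farther away, where several shortest
lifts may exist, its values are arbitrary choices.\<close>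

definition nearest_lift :: "torus \<Rightarrow> real \<times> real"
  where "nearest_lift z = (SOME a. to_torus a = z \<and> norm a = dist z 0)"

lemma nearest_lift: "to_torus (nearest_lift z) = z" "norm (nearest_lift z) = dist z 0"
proof -
  obtain a where a: "z = to_torus a" by (rule to_torus_surj)
  obtain l where l: "l \<in> Z2" "infdist a Z2 = dist a l"
    using infdist_attains_inf[OF closed_Z2, of a] Z2_zero by blast
  have "to_torus (a - l) = z \<and> norm (a - l) = dist z 0"
    using l dist_to_torus[of a 0] Z2_minus[of l] by (simp add: a to_torus_eq_iff to_torus_zero dist_norm)
  then have "to_torus (nearest_lift z) = z \<and> norm (nearest_lift z) = dist z 0"
    unfolding nearest_lift_def by (rule someI)
  then show "to_torus (nearest_lift z) = z" "norm (nearest_lift z) = dist z 0" by auto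
qed

lemma continuous_on_nearest_lift: "continuous_on (ball 0 (1/4)) nearest_lift"
proof (rule continuous_onI)
  fix z :: torus and e :: real assume z: "z \<in> ball 0 (1/4)" and e: "e > 0"
  \<comment> \<open>On this ball lifts differ by vectors of length at most \<open>1/2\<close>, for which \<open>0\<close> is a nearest lattice
    point, so the lift is an isometry.\<close>
  have "dist (nearest_lift w) (nearest_lift z) = dist w z" if "w \<in> ball 0 (1/4)" for w
  proof -
    have "norm (nearest_lift w - nearest_lift z) \<le> 1 / 2"
      using norm_triangle_ineq4[of "nearest_lift w" "nearest_lift z"] that z
      by (simp add: nearest_lift dist_commute)
    from infdist_Z2_small[OF this] show ?thesis
      using dist_to_torus[of "nearest_lift w" "nearest_lift z"] by (simp add: nearest_lift dist_norm)
  qed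
  then show "\<exists>d>0. \<forall>w\<in>ball 0 (1/4). dist w z < d \<longrightarrow> dist (nearest_lift w) (nearest_lift z) \<le> e"
    using e by (intro exI[of _ e]) auto
qed

lemma homotopic_with_canon_UNIV_iff:
  "homotopic_with_canon P UNIV UNIV p q \<longleftrightarrow>
    (\<exists>k. continuous_on ({0..1} \<times> UNIV) k \<and> (\<forall>x. k (0::real, x) = p x) \<and> (\<forall>x. k (1, x) = q x)
      \<and> (\<forall>t\<in>{0..1}. P (\<lambda>x. k (t, x))))"
  unfolding homotopic_with_def prod_topology_subtopology_eu continuous_map_subtopology_eu
  by (simp add: Pi_iff)

text \<open>The displacement of \<open>g\<close> lifts to a map from the torus into the plane. By uniform continuity the homotopy
can be cut into finitely many steps that move every point by less than \<open>1/4\<close>; each step has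
its shortest lift, and \<open>D\<close> is their sum. A lift of \<open>g\<close> itself is then \<open>a + D (to_torus a)\<close>, visibly
equivariant and of bounded displacement.\<close>

lemma lift_displacement:
  fixes g :: "torus \<Rightarrow> torus"
  assumes "homotopic_with_canon (\<lambda>_. True) UNIV UNIV id g"
  obtains D :: "torus \<Rightarrow> real \<times> real"
  where "continuous_on UNIV D" "\<And>z. g z = z + to_torus (D z)"
proof -
  obtain k where k: "continuous_on ({0..1} \<times> UNIV) k" "\<And>z. k (0::real, z) = z" "\<And>z. k (1, z) = g z"
    using assms unfolding homotopic_with_canon_UNIV_iff by auto
  have "compact ({0..1::real} \<times> (UNIV :: torus set))"
    by (intro compact_Times compact_Icc compact_torus)
  then have "uniformly_continuous_on ({0..1} \<times> UNIV) k"
    by (intro compact_uniformly_continuous k)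
  then have "\<exists>d>0. \<forall>x\<in>{0..1} \<times> UNIV. \<forall>y\<in>{0..1} \<times> UNIV. dist y x < d \<longrightarrow> dist (k y) (k x) < 1/4"
    unfolding uniformly_continuous_on_def by (elim allE[of _ "1/4"]) simp
  then obtain d where d: "d > 0"
    "\<And>x y. x \<in> {0..1} \<times> UNIV \<Longrightarrow> y \<in> {0..1} \<times> UNIV \<Longrightarrow> dist y x < d \<Longrightarrow> dist (k y) (k x) < 1/4"
    by blast
  obtain n where n: "n > 0" "1 / real n < d"
    using nat_approx_posE[OF d(1)] by (metis of_nat_0_less_iff zero_less_Suc)
  define t where "t i = real i / real n" for i
  have t: "t i \<in> {0..1}" if "i \<le> n" for i
    using that n(1) by (simp add: t_def)
  have step: "k (t (Suc i), z) - k (t i, z) \<in> ball 0 (1/4)" if "i < n" for i z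
  proof -
    have "dist (t (Suc i), z) (t i, z) = 1 / real n"
      by (simp add: t_def dist_Pair_Pair dist_real_def diff_divide_distrib[symmetric])
    then have "dist (k (t (Suc i), z)) (k (t i, z)) < 1/4"
      using that t n(2) by (intro d(2)) auto
    then show ?thesis
      using dist_torus_diff by (simp add: dist_commute)
  qed
  define D where "D z = (\<Sum>i<n. nearest_lift (k (t (Suc i), z) - k (t i, z)))" for z
  have kt: "continuous_on UNIV (\<lambda>z. k (t i, z))" if "i \<le> n" for i
    by (rule continuous_on_compose2[OF k(1)]) (use t[OF that] in \<open>auto intro!: continuous_intros\<close>)
  have "continuous_on UNIV D"
    unfolding D_def
  proof (intro continuous_on_sum)
    fix i assume "i \<in> {..<n}"
    then have i: "i < n" by simp
    show "continuous_on UNIV (\<lambda>z. nearest_lift (k (t (Suc i), z) - k (t i, z)))"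
      using step[OF i] i
      by (intro continuous_on_compose2[OF continuous_on_nearest_lift] continuous_on_diff kt image_subsetI) auto
  qed
  moreover have "g z = z + to_torus (D z)" for z
  proof -
    have "to_torus (D z) = (\<Sum>i<n. k (t (Suc i), z) - k (t i, z))"
      by (simp add: D_def to_torus_sum nearest_lift)
    also have "\<dots> = k (t n, z) - k (t 0, z)"
      by (rule sum_lessThan_telescope)
    also have "\<dots> = g z - z"
      using n(1) k by (simp add: t_def)
    finally show ?thesis by simp
  qed
  ultimately show thesis using that by blast
qed

lemma continuous_Z2_valued_constant:
  fixes u :: "real \<times> real \<Rightarrow> real \<times> real"
  assumes "continuous_on UNIV u" "\<And>a. u a \<in> Z2"
  obtains l where "l \<in> Z2" "\<And>a. u a = l"
proof -
  have "(\<lambda>a. p (u a)) constant_on UNIV" if p: "p = fst \<or> p = snd" for p :: "real \<times> real \<Rightarrow> real"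
  proof (rule continuous_discrete_range_constant[OF connected_UNIV])
    show "continuous_on UNIV (\<lambda>a. p (u a))" using p assms(1) by (auto intro!: continuous_intros)
    fix a
    have "1 \<le> norm (p (u b) - p (u a))" if "p (u b) \<noteq> p (u a)" for b
      using Ints_nonzero_abs_ge1[of "p (u b) - p (u a)"] assms(2)[of a] assms(2)[of b] that p
      by (auto simp: mem_Times_iff)
    then show "\<exists>e>0. \<forall>b. b \<in> UNIV \<and> p (u b) \<noteq> p (u a) \<longrightarrow> e \<le> norm (p (u b) - p (u a))"
      by (intro exI[of _ 1]) auto
  qed
  from this[of fst] this[of snd] obtain m n where "\<And>a. fst (u a) = m" "\<And>a. snd (u a) = n"
    by (auto simp: constant_on_def)
  then have "u a = u 0" for a by (simp add: prod_eq_iff)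
  then show thesis using that[of "u 0"] assms(2) by blast
qed

definition to_complex :: "real \<times> real \<Rightarrow> complex"
  where "to_complex a = Complex (fst a) (snd a)"

definition of_complex :: "complex \<Rightarrow> real \<times> real"
  where "of_complex z = (Re z, Im z)"

lemma of_to_complex: "of_complex (to_complex a) = a" "to_complex (of_complex z) = z"
  by (simp_all add: of_complex_def to_complex_def)

lemma norm_to_complex: "norm (to_complex a - to_complex b) = norm (a - b)"
  by (cases a; cases b) (simp add: to_complex_def cmod_def norm_Pair)

lemma continuous_on_to_complex: "continuous_on S to_complex"
  by (intro continuous_onI exI conjI) (auto simp: dist_norm norm_to_complex)

lemma continuous_on_of_complex: "continuous_on S of_complex"
  unfolding of_complex_def by (intro continuous_intros)

text \<open>Lift \<open>g\<close> to \<open>G\<close> and \<open>h\<close> to \<open>H\<close>. Since \<open>g\<close> preserves the fibres of \<open>h\<close>, the maps \<open>H \<circ> G\<close> and \<open>H\<close> differ by a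
constant lattice vector, which can be absorbed into \<open>G\<close>. Then \<open>G\<close> preserves the fibres of \<open>H\<close>. These are
bounded because \<open>H\<close> is at bounded distance from the identity, so all orbits of \<open>G\<close> are bounded and
\<open>G\<close> has a fixed point.\<close>

lemma fixed_point_if_fibres_preserved:
  fixes g h :: "torus \<Rightarrow> torus"
  assumes g: "continuous_on UNIV g" "inj g" "homotopic_with_canon (\<lambda>_. True) UNIV UNIV id g"
    and h: "homotopic_with_canon (\<lambda>_. True) UNIV UNIV id h"
    and hg: "\<And>z. h (g z) = h z"
  shows "\<exists>z. g z = z"
proof -
  obtain D where D: "continuous_on UNIV D" "\<And>z. g z = z + to_torus (D z)"
    using lift_displacement[OF g(3)] by blast
  obtain E where E: "continuous_on UNIV E" "\<And>z. h z = z + to_torus (E z)"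
    using lift_displacement[OF h] by blast
  have bounded: "bounded (range F)" if "continuous_on UNIV F" for F :: "torus \<Rightarrow> real \<times> real"
    by (intro compact_imp_bounded compact_continuous_image that compact_torus)
  have cont: "continuous_on UNIV (\<lambda>a. F (to_torus a))" if "continuous_on UNIV F"
    for F :: "torus \<Rightarrow> real \<times> real"
    by (rule continuous_on_compose2[OF that continuous_on_to_torus]) simp
  define G0 where "G0 a = a + D (to_torus a)" for a
  define H where "H a = a + E (to_torus a)" for a
  have G0: "to_torus (G0 a) = g (to_torus a)" and H: "to_torus (H a) = h (to_torus a)" for a
    by (simp_all add: G0_def H_def to_torus_add D E)
  have contG0: "continuous_on UNIV G0" and contH: "continuous_on UNIV H"
    unfolding G0_def H_def by (intro continuous_intros cont D E)+
  have "continuous_on UNIV (\<lambda>a. H (G0 a) - H a)"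
    by (intro continuous_intros contH continuous_on_compose2[OF contH contG0]) simp
  moreover have "H (G0 a) - H a \<in> Z2" for a
    using hg[of "to_torus a"] unfolding to_torus_eq_iff[symmetric] H G0 .
  ultimately obtain l where l: "l \<in> Z2" "\<And>a. H (G0 a) - H a = l"
    using continuous_Z2_valued_constant by blast
  define G where "G a = G0 a - l" for a
  have proj_l: "to_torus (a - l) = to_torus a" for a
    using l(1) Z2_minus[of l] by (simp add: to_torus_eq_iff)
  have G: "to_torus (G a) = g (to_torus a)" for a
    by (simp add: G_def proj_l G0)
  have HG: "H (G a) = H a" for a
    using l(2)[of a] by (simp add: G_def H_def proj_l algebra_simps)
  have injG: "inj G"
  proof (rule injI)
    fix a b assume "G a = G b"
    then have "to_torus a = to_torus b" using G g(2) by (metis injD)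
    with \<open>G a = G b\<close> show "a = b" by (simp add: G_def G0_def)
  qed
  obtain B where B: "\<And>z. norm (E z) \<le> B" using bounded[OF E(1)] unfolding bounded_iff by blast
  have orbit: "norm ((G ^^ n) a) \<le> norm a + 2 * B" for n a
  proof -
    have "H ((G ^^ n) a) = H a" by (induction n) (simp_all add: HG)
    then have "(G ^^ n) a = a + (E (to_torus a) - E (to_torus ((G ^^ n) a)))"
      by (simp add: H_def algebra_simps)
    then show ?thesis
      using norm_triangle_ineq[of a "E (to_torus a) - E (to_torus ((G ^^ n) a))"]
        norm_triangle_ineq4[of "E (to_torus a)" "E (to_torus ((G ^^ n) a))"]
        B[of "to_torus a"] B[of "to_torus ((G ^^ n) a)"] by simp
  qed
  define F where "F z = to_complex (G (of_complex z))" for z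
  have "near_id_embedding F"
    unfolding near_id_embedding_def
  proof (intro conjI)
    have "continuous_on UNIV G" unfolding G_def by (intro continuous_intros contG0)
    then show "continuous_on UNIV F"
      unfolding F_def
      by (intro continuous_on_compose2[OF continuous_on_to_complex]
          continuous_on_compose2[OF _ continuous_on_of_complex]) auto
    show "inj F"
      unfolding F_def by (rule injI) (metis injG injD of_to_complex)
    obtain C where C: "\<And>z. norm (D z) \<le> C" using bounded[OF D(1)] unfolding bounded_iff by blast
    have "norm (F z - z) \<le> C + norm l" for z
    proof -
      have "norm (F z - z) = norm (G (of_complex z) - of_complex z)"
        using norm_to_complex[of "G (of_complex z)" "of_complex z"] by (simp add: F_def of_to_complex)
      then show ?thesis
        using norm_triangle_ineq4[of "D (to_torus (of_complex z))" l] C[of "to_torus (of_complex z)"]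
        by (simp add: G_def G0_def algebra_simps)
    qed
    then show "bounded (range (\<lambda>z. F z - z))" unfolding bounded_iff by blast
  qed
  moreover have "bounded (range (\<lambda>n. (F ^^ n) 0))"
  proof -
    have "(F ^^ n) (to_complex 0) = to_complex ((G ^^ n) 0)" for n
      by (induction n) (simp_all add: F_def of_to_complex)
    moreover have "to_complex 0 = 0" by (simp add: to_complex_def complex_eq_iff)
    ultimately have "norm ((F ^^ n) 0) \<le> norm (0::real \<times> real) + 2 * B" for n
      using orbit[of n 0] norm_to_complex[of "(G ^^ n) 0" 0] by simp
    then show ?thesis unfolding bounded_iff by blast
  qed
  ultimately obtain z where "F z = z"
    using bounded_orbit_fixed_point by blast
  then have "G (of_complex z) = of_complex z" unfolding F_def by (metis of_to_complex(1))
  then show ?thesis using G by metis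
qed

section \<open>Maps commuting with a minimal homeomorphism\<close>

lemma minimal_invariant_closed_set:
  assumes "minimal f" "bij f" "closed S" "S \<noteq> {}" and inv: "\<And>x. f x \<in> S \<longleftrightarrow> x \<in> S"
  shows "S = UNIV"
proof -
  obtain x where x: "x \<in> S" using assms(4) by blast
  have "(f ^^ n) x \<in> S" for n
    by (induction n) (simp_all add: x inv)
  moreover have "inv_into UNIV f y \<in> S" if "y \<in> S" for y
    using that inv[of "inv_into UNIV f y"] assms(2) by (simp add: bij_is_surj surj_f_inv_f)
  then have "(inv_into UNIV f ^^ n) x \<in> S" for n
    by (induction n) (simp_all add: x)
  ultimately have "orbit f x \<subseteq> S" by (auto simp: orbit_def)
  then have "closure (orbit f x) \<subseteq> S" using assms(3) by (rule closure_minimal)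
  then show ?thesis using assms(1) by (simp add: minimal_def top.extremum_unique)
qed

lemma minimal_invariant_function_constant:
  fixes u :: "torus \<Rightarrow> 'a::t2_space"
  assumes "minimal f" "bij f" "continuous_on UNIV u" "\<And>x. u (f x) = u x"
  shows "u x = u y"
proof -
  have "{x. u x = u y} = UNIV"
    using assms by (intro minimal_invariant_closed_set[of f] closed_Collect_eq continuous_on_const) auto
  then show ?thesis by blast
qed

text \<open>The difference \<open>k \<circ> g - k\<close> is continuous and invariant under the minimal map \<open>f\<close>, hence constant.\<close>

lemma commuting_map_is_translation_downstairs:
  assumes "minimal f" "bij f" "continuous_on UNIV k" "k \<circ> f = translation \<alpha> \<circ> k"
    and "continuous_on UNIV g" "g \<circ> f = f \<circ> g"
  shows "k (g x) = k x + (k (g y) - k y)"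
proof -
  have kf: "k (f x) = k x + \<alpha>" and gf: "g (f x) = f (g x)" for x
    using assms(4,6) by (simp_all add: fun_eq_iff translation_def)
  have "continuous_on UNIV (\<lambda>x. k (g x) - k x)"
    by (intro continuous_intros assms(3) continuous_on_compose2[OF assms(3,5)]) simp
  then have "k (g x) - k x = k (g y) - k y"
    by (rule minimal_invariant_function_constant[OF assms(1,2)]) (simp add: kf gf)
  then show ?thesis by (metis add.commute diff_add_cancel)
qed

section \<open>Uniform limits of volume preserving maps\<close>

lemma emeasure_vol_UNIV_finite: "emeasure vol UNIV \<noteq> \<infinity>"
proof -
  have "bounded ({0..<1} \<times> {0..<1} :: (real \<times> real) set)"
    by (intro bounded_Times) (auto intro: bounded_subset[OF bounded_closed_interval])
  then have "emeasure lborel ({0..<1} \<times> {0..<1} :: (real \<times> real) set) < \<infinity>"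
    by (rule emeasure_bounded_finite)
  then show ?thesis by (simp add: emeasure_vol)
qed

text \<open>Two finite Borel measures agree once they agree on open sets. An open set \<open>U\<close> is exhausted by the sets
\<open>core U n\<close> of points at distance at least \<open>1 / Suc n\<close> from its complement. If \<open>k\<close> is closer to \<open>g\<close> than
that, then \<open>k\<close> maps into \<open>U\<close> whatever \<open>g\<close> maps into the core, and conversely; so the inequality for
the cores holds in both directions and passes to the limit.\<close>

lemma vol_preserving_uniform_limit:
  assumes g: "continuous_on UNIV g"
    and approx: "\<And>e. e > 0 \<Longrightarrow> \<exists>k. k \<in> Homeo_vol \<and> (\<forall>x. dist (k x) (g x) < e)"
  shows "distr vol vol g = vol"
proof -
  have g_meas [measurable]: "g \<in> measurable vol vol"
    using borel_measurable_continuous_onI[OF g] by (simp cong: measurable_cong_sets)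
  \<comment> \<open>defined without \<open>infdist\<close>, which would be \<open>0\<close> for the empty complement of \<open>UNIV\<close>\<close>
  define core where "core U n = {x. \<forall>y. y \<notin> U \<longrightarrow> 1 / real (Suc n) \<le> dist x y}" for U :: "torus set" and n
  have core_sets: "core U n \<in> sets borel" for U n
  proof -
    have "closed {x. 1 / real (Suc n) \<le> dist x y}" for y :: torus
      by (intro closed_Collect_le continuous_intros)
    then have "closed (\<Inter>y\<in>-U. {x. 1 / real (Suc n) \<le> dist x y})" by blast
    also have "(\<Inter>y\<in>-U. {x. 1 / real (Suc n) \<le> dist x y}) = core U n" by (auto simp: core_def)
    finally show ?thesis by (rule borel_closed)
  qed
  have core_mono: "incseq (core U)" for U
  proof (rule incseq_SucI)
    fix n
    have "1 / real (Suc (Suc n)) \<le> 1 / real (Suc n)" by (simp add: frac_le)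
    then show "core U n \<subseteq> core U (Suc n)" unfolding core_def using order_trans by blast
  qed
  have core_Un: "(\<Union>n. core U n) = U" if U: "open U" for U
  proof (intro equalityI subsetI)
    fix x assume "x \<in> (\<Union>n. core U n)"
    then obtain n where n: "x \<in> core U n" by blast
    show "x \<in> U"
    proof (rule ccontr)
      assume "x \<notin> U"
      then have "1 / real (Suc n) \<le> dist x x" using n unfolding core_def by blast
      moreover have "1 / real (Suc n) > 0" by simp
      ultimately show False by (simp del: of_nat_Suc)
    qed
  next
    fix x assume "x \<in> U"
    then obtain e where e: "e > 0" "ball x e \<subseteq> U" using U openE by blast
    obtain n where "1 / real (Suc n) < e" using nat_approx_posE[OF e(1)] by blast
    then have "x \<in> core U n" using e(2) unfolding core_def by (force simp: subset_iff)
    then show "x \<in> (\<Union>n. core U n)" by blast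
  qed
  have near: "k y \<in> U" if "x \<in> core U n" "dist x (k y) < 1 / real (Suc n)"
    for U n x y and k :: "torus \<Rightarrow> torus"
    using that unfolding core_def by (metis (mono_tags, lifting) mem_Collect_eq not_less)
  have exhaust: "emeasure M U \<le> c"
    if "open U" "sets M = sets borel" "\<And>n. emeasure M (core U n) \<le> c" for M :: "torus measure" and U c
  proof -
    have "(SUP n. emeasure M (core U n)) = emeasure M U"
      using SUP_emeasure_incseq[of "core U" M] core_sets core_mono core_Un[OF that(1)] that(2) by auto
    then show ?thesis using that(3) by (metis SUP_least)
  qed
  have eq_open: "emeasure (distr vol vol g) U = emeasure vol U" if U: "open U" for U
  proof (rule antisym)
    have k_meas: "emeasure vol (k -` A) = emeasure vol A" if "k \<in> Homeo_vol" "A \<in> sets borel" for k A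
    proof -
      have "k \<in> measurable vol vol" "distr vol vol k = vol"
        using that(1) Homeo_measurable by (auto simp: Homeo_vol_def)
      then show ?thesis
        using emeasure_distr[of k vol vol A] that(2) by (simp add: sets_eq_imp_space_eq[OF sets_vol])
    qed
    have g_distr: "emeasure (distr vol vol g) A = emeasure vol (g -` A)" if "A \<in> sets borel" for A
      using emeasure_distr[of g vol vol A] that by (simp add: sets_eq_imp_space_eq[OF sets_vol])
    have pre: "k -` A \<in> sets borel" if "continuous_on UNIV k" "A \<in> sets borel"
      for k :: "torus \<Rightarrow> torus" and A
      using measurable_sets[OF borel_measurable_continuous_onI[OF that(1)] that(2)] by simp
    have U_borel: "U \<in> sets borel" using U by simp
    show "emeasure (distr vol vol g) U \<le> emeasure vol U"
    proof (rule exhaust[OF U])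
      fix n
      obtain k where k: "k \<in> Homeo_vol" "\<And>x. dist (k x) (g x) < 1 / real (Suc n)"
        using approx[of "1 / real (Suc n)"] by auto
      have "g -` core U n \<subseteq> k -` U"
      proof
        fix x assume "x \<in> g -` core U n"
        then show "x \<in> k -` U" using near[of "g x" U n k x] k(2)[of x] by (simp add: dist_commute)
      qed
      moreover have "k -` U \<in> sets vol"
        using pre[OF Homeo_continuous U_borel] k(1) by (simp add: Homeo_vol_def)
      ultimately show "emeasure (distr vol vol g) (core U n) \<le> emeasure vol U"
        unfolding g_distr[OF core_sets] k_meas[OF k(1) U_borel, symmetric] by (rule emeasure_mono)
    qed simp
    show "emeasure vol U \<le> emeasure (distr vol vol g) U"
    proof (rule exhaust[OF U])
      fix n
      obtain k where k: "k \<in> Homeo_vol" "\<And>x. dist (k x) (g x) < 1 / real (Suc n)"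
        using approx[of "1 / real (Suc n)"] by auto
      have "k -` core U n \<subseteq> g -` U"
      proof
        fix x assume "x \<in> k -` core U n"
        then show "x \<in> g -` U" using near[of "k x" U n g x] k(2)[of x] by simp
      qed
      moreover have "g -` U \<in> sets vol"
        using pre[OF g U_borel] by simp
      ultimately show "emeasure vol (core U n) \<le> emeasure (distr vol vol g) U"
        unfolding g_distr[OF U_borel] k_meas[OF k(1) core_sets, symmetric] by (rule emeasure_mono)
    qed simp
  qed
  show ?thesis
  proof (rule measure_eqI_generator_eq[where E = "{U. open U}" and \<Omega> = UNIV and A = "\<lambda>_. UNIV"])
    show "Int_stable {U :: torus set. open U}" by (auto simp: Int_stable_def)
    show "emeasure (distr vol vol g) X = emeasure vol X" if "X \<in> {U. open U}" for X
      using that eq_open by simp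
    show "sets (distr vol vol g) = sigma_sets UNIV {U. open U}" "sets vol = sigma_sets UNIV {U. open U}"
      by (simp_all add: borel_def)
    show "emeasure (distr vol vol g) UNIV \<noteq> \<infinity>" for i :: nat
      using emeasure_vol_UNIV_finite eq_open[of UNIV] by simp
  qed auto
qed

section \<open>Linearizability and compactness of the centralizer\<close>

lemma translation_Homeo: "translation b \<in> Homeo"
  unfolding Homeo_def homeomorphism_def mem_Collect_eq
  by (intro exI[of _ "translation (- b)"])
    (auto simp: translation_def surj_def intro!: continuous_intros exI[of _ "_ - b"] exI[of _ "_ + b"])

text \<open>In the coordinate \<open>\<phi>\<close> every commuting map is a translation. That every translation, conversely,
preserves volume is the substantial part: the translations that do form a closed set of parameters which is
invariant under adding and subtracting \<open>\<alpha>\<close> because \<open>f\<close> preserves volume, and minimality of \<open>f\<close> leaves no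
room for a proper such set. Sliding the translation vector to \<open>0\<close> gives the isotopy.\<close>

lemma linearizable_centralizer_eq:
  assumes f: "f \<in> Homeo_vol" "minimal f"
    and \<phi>: "\<phi> \<in> Homeo" "\<phi> \<circ> f = translation \<alpha> \<circ> \<phi>"
  shows "centralizer0 f = range (\<lambda>b. inv_into UNIV \<phi> \<circ> translation b \<circ> \<phi>)"
proof -
  let ?\<psi> = "inv_into UNIV \<phi>"
  define C where "C b = ?\<psi> \<circ> translation b \<circ> \<phi>" for b
  have \<phi>\<psi>: "\<phi> (?\<psi> x) = x" and \<psi>\<phi>: "?\<psi> (\<phi> x) = x" for x
    using Homeo_bij[OF \<phi>(1)] by (simp_all add: bij_is_surj surj_f_inv_f bij_is_inj)
  have cont: "continuous_on UNIV \<phi>" "continuous_on UNIV ?\<psi>"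
    by (simp_all add: Homeo_continuous Homeo_inv \<phi>)
  have bij: "bij f" and fH: "f \<in> Homeo" using f(1) Homeo_bij by (auto simp: Homeo_vol_def)
  have f_eq: "f = C \<alpha>"
  proof
    fix x
    have "\<phi> (f x) = \<phi> (C \<alpha> x)" using \<phi>(2) by (simp add: fun_eq_iff C_def \<phi>\<psi>)
    then show "f x = C \<alpha> x" by (metis \<psi>\<phi>)
  qed
  have C_add: "C a \<circ> C b = C (b + a)" for a b
    by (auto simp: C_def \<phi>\<psi> translation_def add.assoc)
  have C_Homeo: "C b \<in> Homeo" for b
    unfolding C_def by (intro Homeo_comp Homeo_inv translation_Homeo \<phi>)
  define S where "S = {b. C b \<in> Homeo_vol}"
  have S_add: "a + b \<in> S" if "a \<in> S" "b \<in> S" for a b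
    using that Homeo_vol_comp[of "C b" "C a"] by (simp add: S_def C_add)
  have \<alpha>S: "\<alpha> \<in> S" using f(1) by (simp add: S_def f_eq[symmetric])
  have "inv_into UNIV f = C (- \<alpha>)"
  proof
    fix x
    have "f (C (- \<alpha>) x) = x" unfolding f_eq by (simp add: C_def \<phi>\<psi> \<psi>\<phi> translation_def)
    then show "inv_into UNIV f x = C (- \<alpha>) x" using bij by (metis bij_inv_eq_iff)
  qed
  then have m\<alpha>S: "- \<alpha> \<in> S" using Homeo_vol_inv[OF f(1)] by (simp add: S_def)
  have "closed S"
    unfolding closed_sequential_limits
  proof (intro allI impI, elim conjE)
    fix s b assume s: "\<forall>n. s n \<in> S" "s \<longlonglongrightarrow> b"
    have "distr vol vol (C b) = vol"
    proof (rule vol_preserving_uniform_limit)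
      show "continuous_on UNIV (C b)" using C_Homeo Homeo_continuous by blast
      fix e :: real assume e: "e > 0"
      have "uniformly_continuous_on UNIV ?\<psi>"
        by (intro compact_uniformly_continuous cont compact_torus)
      then obtain d where d: "d > 0" "\<And>x y. dist y x < d \<Longrightarrow> dist (?\<psi> y) (?\<psi> x) < e"
        using e unfolding uniformly_continuous_on_def by (metis UNIV_I)
      obtain n where "dist (s n) b < d"
        using s(2) d(1) unfolding lim_sequentially by blast
      then have "dist (C (s n) x) (C b x) < e" for x
        using d(2)[of "translation (s n) (\<phi> x)" "translation b (\<phi> x)"]
          dist_torus_translate[of "s n" "\<phi> x" b]
        by (simp add: C_def translation_def add.commute)
      then show "\<exists>k. k \<in> Homeo_vol \<and> (\<forall>x. dist (k x) (C b x) < e)"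
        using s(1) by (auto simp: S_def)
    qed
    then show "b \<in> S" using C_Homeo by (simp add: S_def Homeo_vol_def)
  qed
  have "\<phi> -` S = UNIV"
  proof (rule minimal_invariant_closed_set[OF f(2) bij])
    show "closed (\<phi> -` S)" using \<open>closed S\<close> cont(1) by (simp add: closed_vimage)
    show "\<phi> -` S \<noteq> {}" using \<alpha>S \<phi>\<psi> by (metis empty_iff vimageI)
    fix x
    have "\<phi> (f x) = \<phi> x + \<alpha>" using \<phi>(2) by (simp add: fun_eq_iff translation_def)
    then show "f x \<in> \<phi> -` S \<longleftrightarrow> x \<in> \<phi> -` S"
      using S_add[OF _ \<alpha>S, of "\<phi> x"] S_add[OF _ m\<alpha>S, of "\<phi> x + \<alpha>"] by auto
  qed
  then have C_vol: "C b \<in> Homeo_vol" for b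
    using \<phi>\<psi>[of b] by (metis S_def UNIV_I mem_Collect_eq vimageD)
  have C_isotopic: "C b \<in> Homeo_isotopic_id" for b
  proof -
    obtain a where a: "b = to_torus a" by (rule to_torus_surj)
    have "continuous_on ({0..1} \<times> UNIV) (\<lambda>x. ?\<psi> (\<phi> (snd x) + to_torus (fst x *\<^sub>R a)))"
      by (intro continuous_intros continuous_on_compose2[OF cont(2)] continuous_on_compose2[OF cont(1)]
          continuous_on_compose2[OF continuous_on_to_torus]) auto
    moreover have "(\<lambda>x. ?\<psi> (\<phi> x + to_torus (t *\<^sub>R a))) \<in> Homeo" for t
      using C_Homeo[of "to_torus (t *\<^sub>R a)"] by (simp add: C_def translation_def o_def)
    ultimately show ?thesis
      unfolding Homeo_isotopic_id_def homotopic_with_canon_UNIV_iff mem_Collect_eq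
      by (intro exI[of _ "\<lambda>x. ?\<psi> (\<phi> (snd x) + to_torus (fst x *\<^sub>R a))"])
        (simp add: to_torus_zero \<psi>\<phi> C_def translation_def a)
  qed
  have "g \<in> range C" if g: "g \<in> centralizer0 f" for g
  proof -
    have "continuous_on UNIV g" "g \<circ> f = f \<circ> g"
      using g Homeo_continuous by (auto simp: centralizer0_def Homeo_vol_def)
    from commuting_map_is_translation_downstairs[OF f(2) bij cont(1) \<phi>(2) this, of _ 0]
    have "\<phi> (g x) = translation (\<phi> (g 0) - \<phi> 0) (\<phi> x)" for x
      unfolding translation_def .
    then have "g x = C (\<phi> (g 0) - \<phi> 0) x" for x
      unfolding C_def o_apply by (metis \<psi>\<phi>)
    then have "g = C (\<phi> (g 0) - \<phi> 0)" by (rule ext)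
    then show ?thesis by blast
  qed
  moreover have "C b \<in> centralizer0 f" for b
    by (simp add: centralizer0_def C_vol C_isotopic f_eq C_add add.commute)
  ultimately have "centralizer0 f = range C" by blast
  then show ?thesis by (simp add: C_def[abs_def])
qed

text \<open>By the previous lemma the centralizer is a continuous image of the torus; continuity in
the supremum metric is the uniform continuity of the inverse of \<open>\<phi>\<close>.\<close>

lemma C0_compact_centralizer_if_linearizable:
  assumes "f \<in> Homeo_vol" "minimal f" "topologically_linearizable f"
  shows "C0_compact (centralizer0 f)"
proof -
  obtain \<phi> \<alpha> where \<phi>: "\<phi> \<in> Homeo" "\<phi> \<circ> f = translation \<alpha> \<circ> \<phi>"
    using assms(3) by (auto simp: topologically_linearizable_def)
  let ?\<psi> = "inv_into UNIV \<phi>"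
  define C where "C b = ?\<psi> \<circ> translation b \<circ> \<phi>" for b
  have eq: "centralizer0 f = range C"
    using linearizable_centralizer_eq[OF assms(1,2) \<phi>] by (simp add: C_def[abs_def])
  have sub: "range C \<subseteq> Homeo"
    using eq by (auto simp: centralizer0_def Homeo_vol_def)
  have "\<exists>\<Phi>. \<forall>b. apply_bcontfun (\<Phi> b) = C b"
  proof (rule choice[of "\<lambda>b \<Phi>. apply_bcontfun \<Phi> = C b"], rule allI)
    fix b
    show "\<exists>\<Phi>. apply_bcontfun \<Phi> = C b"
      using bij_betw_imp_surj_on[OF bij_betw_C0[OF sub]] by (metis (no_types, lifting) imageE rangeI)
  qed
  then obtain \<Phi> where \<Phi>: "\<And>b. apply_bcontfun (\<Phi> b) = C b" by blast
  have "continuous_on UNIV \<Phi>"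
  proof (rule continuous_onI)
    fix b :: torus and e :: real assume e: "e > 0"
    have "uniformly_continuous_on UNIV ?\<psi>"
      by (intro compact_uniformly_continuous Homeo_continuous Homeo_inv \<phi> compact_torus)
    then obtain d where d: "d > 0" "\<And>x y. dist y x < d \<Longrightarrow> dist (?\<psi> y) (?\<psi> x) < e"
      using e unfolding uniformly_continuous_on_def by (metis UNIV_I)
    have "dist (\<Phi> c) (\<Phi> b) \<le> e" if "dist c b < d" for c
    proof (rule dist_bound)
      fix x
      show "dist (\<Phi> c x) (\<Phi> b x) \<le> e"
        using d(2)[of "translation c (\<phi> x)" "translation b (\<phi> x)"] that
          dist_torus_translate[of c "\<phi> x" b]
        by (simp add: \<Phi> C_def translation_def add.commute)
    qed
    then show "\<exists>d>0. \<forall>c\<in>UNIV. dist c b < d \<longrightarrow> dist (\<Phi> c) (\<Phi> b) \<le> e"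
      using d(1) by blast
  qed
  then have "compact (range \<Phi>)"
    by (rule compact_continuous_image) (rule compact_torus)
  moreover have "{\<Psi>. apply_bcontfun \<Psi> \<in> range C} = range \<Phi>"
    using \<Phi> by (auto simp: apply_bcontfun_inject[symmetric])
  ultimately show ?thesis by (simp add: C0_compact_def eq)
qed

text \<open>The orbit of \<open>0\<close> under a compact centralizer is closed and \<open>f\<close>-invariant, hence everything. Two points
\<open>g 0\<close> and \<open>k 0\<close> with the same image under \<open>h\<close> then coincide because \<open>g = k\<close>. So \<open>h\<close> is injective,
and a continuous bijection of the compact torus is a homeomorphism.\<close>

lemma linearizable_if_C0_compact_centralizer:
  assumes f: "f \<in> centralizer0 f" "minimal f"
    and h: "continuous_on UNIV h" "surj h" "h \<circ> f = translation \<omega> \<circ> h"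
    and compact: "C0_compact (centralizer0 f)"
    and \<rho>_inj: "\<And>g k. g \<in> centralizer0 f \<Longrightarrow> k \<in> centralizer0 f \<Longrightarrow> h (g 0) = h (k 0) \<Longrightarrow> g = k"
  shows "topologically_linearizable f"
proof -
  let ?G = "centralizer0 f"
  have sub: "?G \<subseteq> Homeo" by (auto simp: centralizer0_def Homeo_vol_def)
  have bij: "bij f" using f(1) sub Homeo_bij by blast
  let ?K = "{\<Phi> :: torus \<Rightarrow>\<^sub>C torus. apply_bcontfun \<Phi> \<in> ?G}"
  have "continuous_on ?K (\<lambda>\<Phi>. apply_bcontfun \<Phi> 0)"
  proof (rule continuous_onI)
    fix \<Phi> :: "torus \<Rightarrow>\<^sub>C torus" and e :: real assume "e > 0"
    moreover have "dist (apply_bcontfun \<Psi> 0) (apply_bcontfun \<Phi> 0) \<le> e" if "dist \<Psi> \<Phi> < e" for \<Psi>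
      using dist_bounded[of \<Psi> 0 \<Phi>] that by linarith
    ultimately show "\<exists>d>0. \<forall>\<Psi>\<in>?K. dist \<Psi> \<Phi> < d \<longrightarrow> dist (apply_bcontfun \<Psi> 0) (apply_bcontfun \<Phi> 0) \<le> e"
      by blast
  qed
  then have "compact ((\<lambda>\<Phi>. apply_bcontfun \<Phi> 0) ` ?K)"
    using compact unfolding C0_compact_def by (rule compact_continuous_image)
  also have "(\<lambda>\<Phi>. apply_bcontfun \<Phi> 0) ` ?K = (\<lambda>g. g 0) ` apply_bcontfun ` ?K"
    by (simp add: image_image)
  also have "apply_bcontfun ` ?K = ?G"
    using bij_betw_imp_surj_on[OF bij_betw_C0[OF sub]] .
  finally have "closed ((\<lambda>g. g 0) ` ?G)" by (rule compact_imp_closed)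
  have "(\<lambda>g. g 0) ` ?G = UNIV"
  proof (rule minimal_invariant_closed_set[OF f(2) bij \<open>closed _\<close>])
    show "(\<lambda>g. g 0) ` ?G \<noteq> {}" using f(1) by blast
    have closed_comp: "g \<circ> k \<in> ?G" if "g \<in> ?G" "k \<in> ?G" for g k
      using that by (auto simp: centralizer0_def fun_eq_iff Homeo_vol_comp Homeo_isotopic_id_comp)
    have "inv_into UNIV f \<circ> f = f \<circ> inv_into UNIV f"
      using bij by (auto simp: fun_eq_iff bij_is_inj bij_is_surj surj_f_inv_f)
    then have f_inv: "inv_into UNIV f \<in> ?G"
      using f(1) by (auto simp: centralizer0_def Homeo_vol_inv Homeo_isotopic_id_inv)
    fix x
    show "f x \<in> (\<lambda>g. g 0) ` ?G \<longleftrightarrow> x \<in> (\<lambda>g. g 0) ` ?G"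
    proof
      assume "f x \<in> (\<lambda>g. g 0) ` ?G"
      then obtain g where g: "g \<in> ?G" "f x = g 0" by blast
      then have "x = (inv_into UNIV f \<circ> g) 0"
        using bij by (metis bij_inv_eq_iff comp_apply)
      then show "x \<in> (\<lambda>g. g 0) ` ?G" using closed_comp[OF f_inv g(1)] by (rule image_eqI)
    next
      assume "x \<in> (\<lambda>g. g 0) ` ?G"
      then obtain g where g: "g \<in> ?G" "x = g 0" by blast
      then have "f x = (f \<circ> g) 0" by simp
      then show "f x \<in> (\<lambda>g. g 0) ` ?G" using closed_comp[OF f(1) g(1)] by (rule image_eqI)
    qed
  qed
  then have "\<exists>g\<in>?G. x = g 0" for x by (metis UNIV_I imageE)
  then have "inj h"
    using \<rho>_inj by (metis injI)
  then obtain k where "homeomorphism UNIV UNIV h k"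
    using homeomorphism_compact[OF compact_torus h(1) h(2)] by blast
  then show ?thesis
    using h(3) by (auto simp: topologically_linearizable_def Homeo_def)
qed

section \<open>The centralizer as a group of rotation vectors\<close>

lemma homotopic_id_if_isotopic_id:
  "g \<in> Homeo_isotopic_id \<Longrightarrow> homotopic_with_canon (\<lambda>_. True) UNIV UNIV id g"
  unfolding Homeo_isotopic_id_def by (auto elim: homotopic_with_mono)

theorem theorem4:
  fixes \<omega> :: torus and f :: "torus \<Rightarrow> torus"
  assumes "totally_irrational \<omega>"
    and "f \<in> Homeo_vol \<inter> semiconj_class \<omega>"
    and "minimal f"
  shows "(\<exists>H. subgroup H torus_group \<and> centralizer0_group f \<cong> torus_group\<lparr>carrier := H\<rparr>)
    \<and> (C0_compact (centralizer0 f) \<longleftrightarrow> topologically_linearizable f)"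
proof -
  let ?G = "centralizer0 f"
  obtain h where h: "continuous_on UNIV h" "surj h" "homotopic_with_canon (\<lambda>_. True) UNIV UNIV h id"
    "h \<circ> f = translation \<omega> \<circ> h" and f_vol: "f \<in> Homeo_vol" and f_iso: "f \<in> Homeo_isotopic_id"
    using assms(2) by (auto simp: semiconj_class_def)
  have bij: "bij f" using f_vol Homeo_bij by (auto simp: Homeo_vol_def)
  have G: "continuous_on UNIV g" "bij g" "g \<circ> f = f \<circ> g" "g \<in> Homeo_isotopic_id" if "g \<in> ?G" for g
    using that Homeo_continuous Homeo_bij by (auto simp: centralizer0_def Homeo_vol_def)
  \<comment> \<open>the rotation vector of \<open>g\<close>; the base point is immaterial by the next step\<close>
  define \<rho> where "\<rho> g = h (g 0) - h 0" for g :: "torus \<Rightarrow> torus"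
  have \<rho>: "h (g x) = h x + \<rho> g" if "g \<in> ?G" for g x
    using commuting_map_is_translation_downstairs[OF assms(3) bij h(1,4) G(1,3)[OF that]]
    unfolding \<rho>_def by blast
  have mult: "g \<otimes>\<^bsub>centralizer0_group f\<^esub> k = g \<circ> k" if "g \<in> ?G" "k \<in> ?G" for g k
    using G(2) that by (auto simp: centralizer0_group_def BijGroup_def Bij_UNIV compose_def fun_eq_iff)
  interpret group_hom "centralizer0_group f" torus_group \<rho>
  proof (rule group_hom.intro[OF group_centralizer0_group group_torus_group], rule group_hom_axioms.intro,
      rule homI)
    fix g k assume "g \<in> carrier (centralizer0_group f)" "k \<in> carrier (centralizer0_group f)"
    then have gk: "g \<in> ?G" "k \<in> ?G" by (auto simp: centralizer0_group_def)
    show "\<rho> (g \<otimes>\<^bsub>centralizer0_group f\<^esub> k) = \<rho> g \<otimes>\<^bsub>torus_group\<^esub> \<rho> k"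
    proof -
      have "\<rho> (g \<circ> k) = h (g (k 0)) - h 0" by (simp add: \<rho>_def)
      also have "\<dots> = \<rho> g + \<rho> k"
        unfolding \<rho>[OF gk(1)] \<rho>[OF gk(2)] by (simp add: add.commute)
      finally show ?thesis by (simp add: mult[OF gk] torus_group_def)
    qed
  qed (simp add: torus_group_def)
  have kernel: "g = id" if g: "g \<in> ?G" "\<rho> g = 0" for g
  proof -
    obtain z where z: "g z = z"
      using fixed_point_if_fibres_preserved[of g h] G[OF g(1)] \<rho>[OF g(1)] g(2) h(3)
        homotopic_id_if_isotopic_id homotopic_with_symD bij_is_inj by (metis add_0_right)
    have "{x. g x = x} = UNIV"
    proof (rule minimal_invariant_closed_set[OF assms(3) bij])
      show "closed {x. g x = x}" by (intro closed_Collect_eq G(1)[OF g(1)] continuous_on_id)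
      have "g (f x) = f (g x)" for x using G(3)[OF g(1)] by (simp add: fun_eq_iff)
      then show "f x \<in> {x. g x = x} \<longleftrightarrow> x \<in> {x. g x = x}" for x
        using bij by (auto dest: bij_is_inj injD)
    qed (use z in auto)
    then show ?thesis by (auto simp: fun_eq_iff)
  qed
  have inj: "inj_on \<rho> (carrier (centralizer0_group f))"
    unfolding inj_on_one_iff
  proof (intro allI impI)
    fix g assume "g \<in> carrier (centralizer0_group f)" "\<rho> g = \<one>\<^bsub>torus_group\<^esub>"
    then have "g = id" using kernel by (simp add: centralizer0_group_def torus_group_def)
    then show "g = \<one>\<^bsub>centralizer0_group f\<^esub>"
      by (auto simp: centralizer0_group_def BijGroup_def)
  qed
  let ?H = "\<rho> ` carrier (centralizer0_group f)"
  have "subgroup ?H torus_group" by (intro subgroup_img_is_subgroup group.subgroup_self group_centralizer0_group)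
  moreover have "\<rho> \<in> iso (centralizer0_group f) (torus_group\<lparr>carrier := ?H\<rparr>)"
    using homh inj by (auto simp: iso_def hom_def bij_betw_def)
  ultimately have "\<exists>H. subgroup H torus_group \<and> centralizer0_group f \<cong> torus_group\<lparr>carrier := H\<rparr>"
    unfolding is_iso_def by blast
  moreover have "C0_compact ?G \<longleftrightarrow> topologically_linearizable f"
  proof
    assume "C0_compact ?G"
    moreover have "f \<in> ?G" using f_vol f_iso by (simp add: centralizer0_def)
    moreover have "g = k" if "g \<in> ?G" "k \<in> ?G" "h (g 0) = h (k 0)" for g k
      using inj that by (auto simp: inj_on_def centralizer0_group_def \<rho>_def)
    ultimately show "topologically_linearizable f"
      using linearizable_if_C0_compact_centralizer[OF _ assms(3) h(1,2,4)] by blast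
  qed (rule C0_compact_centralizer_if_linearizable[OF f_vol assms(3)])
  ultimately show ?thesis ..
qed

end
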